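(* Let $G$ be a connected graph with order $n$ and diameter $d$. Then $m_G(-1)=n-d$ if and only if $G$ is of one of the following forms: (i) $G$ is a complete graph with $n\geq 2$; (ii) $G^c\cong P_5$; (iii) $d\geq 7$, $d\equiv 1\pmod 3$ and $G^c$ is isomorphic to $P_{d+1}\diamond W$, where $P_{d+1}=v_0v_1\cdots v_{d-1}v_d$ and $W$ is a subset of the set $U=\{v_3,v_6,\ldots,v_{d-4}\}$.
   Context: All graphs are finite, simple and undirected. The order $n$ of $G$ is its number of vertices; the diameter $d$ is the greatest distance between two vertices of $G$. $m_G(-1)$ denotes the multiplicity of $-1$ as an eigenvalue of the adjacency matrix of $G$ (equal to $0$ if $-1$ is not an eigenvalue). $P_k$ denotes the path with $k$ vertices. The closed neighborhood of $v$ is $N_G[v]=N_G(v)\cup\{v\}$, where $N_G(v)$ is the set of neighbors of $v$. Define the equivalence relation $\rho$ on $V(G)$ by $u\,\rho\, v$ if and only if $N_G[u]=N_G[v]$. It divides $V(G)$ into classes $C_1,\dots,C_k$, each inducing a complete graph. The $C$-canonical graph $G^c$ of $G$ is the graph obtained from $G$ by identifying all vertices of the same class $C_i$ to a single vertex, for $i=1,\dots,k$; that is, $G^c$ has vertices $c_1,\dots,c_k$, and for $i\ne j$, $c_i$ and $c_j$ are adjacent if and only if some (equivalently every) vertex of $C_i$ is adjacent in $G$ to some (equivalently every) vertex of $C_j$. For a path $P_{d+1}=v_0v_1\cdots v_d$ of length $d$ (that is, with edges $v_0v_1,\dots,v_{d-1}v_d$) and a (possibly empty) subset $W=\{v_{i_1},\dots,v_{i_k}\}$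 of its vertices with all indices at most $d-1$, $P_{d+1}\diamond W$ is the graph obtained from $P_{d+1}$ by adding $k$ new distinct, pairwise nonadjacent vertices $u_{i_1},\dots,u_{i_k}$ such that, for each $j\in\{i_1,\dots,i_k\}$, the neighbors of $u_j$ are exactly $v_j$ and $v_{j+1}$. *)

theory Defs
  imports "Graph_Theory.Graph_Theory" "Jordan_Normal_Form.Char_Poly"
begin

(* Graphs are pair_graph structures of Graph_Theory: finite, symmetric and loop-free sets of
   arcs (u, v); an undirected edge uv is the pair of arcs (u, v), (v, u). *)

subsection \<open>Distance and diameter\<close>

definition graph_dist :: "'a pair_pre_digraph \<Rightarrow> 'a \<Rightarrow> 'a \<Rightarrow> nat" where
  "graph_dist G u v = (LEAST k. \<exists>p. pre_digraph.awalk (with_proj G) u p v \<and> length p = k)"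

definition graph_diameter :: "'a pair_pre_digraph \<Rightarrow> nat" where
  "graph_diameter G = Max {graph_dist G u v |u v. u \<in> pverts G \<and> v \<in> pverts G}"

subsection \<open>Multiplicity of an eigenvalue of the adjacency matrix\<close>

definition adjacency_matrix :: "'a pair_pre_digraph \<Rightarrow> 'a list \<Rightarrow> real mat" where
  "adjacency_matrix G vs =
     mat (length vs) (length vs) (\<lambda>(i, j). if (vs ! i, vs ! j) \<in> parcs G then 1 else 0)"

(* Multiplicity as a root of the characteristic polynomial. The enumeration vs of the vertices is
   arbitrary: see eigenvalue_multiplicity_eq below. *)
definition eigenvalue_multiplicity :: "'a pair_pre_digraph \<Rightarrow> real \<Rightarrow> nat" where
  "eigenvalue_multiplicity G x =
     (let vs = (SOME vs. distinct vs \<and> set vs = pverts G)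
      in Polynomial.order x (char_poly (adjacency_matrix G vs)))"

lemma char_poly_adjacency_matrix_cong:
  assumes vs: "distinct vs" and ws: "distinct ws" and eq: "set vs = set ws"
  shows "char_poly (adjacency_matrix G vs) = char_poly (adjacency_matrix G ws)"
proof -
  define n where "n = length vs"
  have nw: "length ws = n"
    using assms n_def by (metis distinct_card)
  define P where "P = mat n n (\<lambda>(i, j). if vs ! i = ws ! j then 1 else (0::real))"
  define Q where "Q = mat n n (\<lambda>(i, j). if ws ! i = vs ! j then 1 else (0::real))"
  define A where "A = adjacency_matrix G vs"
  define B where "B = adjacency_matrix G ws"
  have carr: "{A, B, P, Q} \<subseteq> carrier_mat n n"
    by (auto simp: A_def B_def P_def Q_def adjacency_matrix_def n_def nw)
  have pick: "\<exists>k<n. xs ! i = ys ! k \<and> (\<forall>l<n. xs ! i = ys ! l \<longrightarrow> l = k)"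
    if "distinct ys" "set xs = set ys" "length xs = n" "length ys = n" "i < n"
    for xs ys :: "'a list" and i
    using that by (metis in_set_conv_nth nth_eq_iff_index_eq)
  have sum1: "(\<Sum>l\<in>{0..<n}. (if l = k then 1 else 0) * f l) = f k"
    and sum2: "(\<Sum>l\<in>{0..<n}. f l * (if l = k then 1 else 0)) = f k"
    if "k < n" for f :: "nat \<Rightarrow> real" and k
    using that by (simp_all add: if_distrib[of "\<lambda>x. x * _"] if_distrib[of "\<lambda>x. _ * x"] cong: if_cong)
  have inv: "mat n n (\<lambda>(i, j). if xs ! i = ys ! j then 1 else (0::real))
      * mat n n (\<lambda>(i, j). if ys ! i = xs ! j then 1 else (0::real)) = 1\<^sub>m n"
    if d: "distinct xs" "distinct ys" "set xs = set ys" "length xs = n" "length ys = n"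
    for xs ys :: "'a list"
  proof (rule eq_matI)
    fix i j assume "i < dim_row (1\<^sub>m n :: real mat)" "j < dim_col (1\<^sub>m n :: real mat)"
    then have ij: "i < n" "j < n" by auto
    obtain k where k: "k < n" "xs ! i = ys ! k" and u: "\<And>l. l < n \<Longrightarrow> xs ! i = ys ! l \<Longrightarrow> l = k"
      using pick[of ys xs i] d ij by blast
    have e: "(xs ! i = ys ! l) = (l = k)" if "l < n" for l
      using that k u by blast
    have "(\<Sum>l\<in>{0..<n}. (if xs ! i = ys ! l then 1 else 0) * (if ys ! l = xs ! j then 1 else (0::real)))
        = (\<Sum>l\<in>{0..<n}. (if l = k then 1 else 0) * (if ys ! l = xs ! j then 1 else 0))"
      by (rule sum.cong) (auto simp: e)
    also have "\<dots> = (if ys ! k = xs ! j then 1 else 0)"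
      using sum1[OF k(1)] .
    also have "\<dots> = (if i = j then 1 else 0)"
      unfolding k(2)[symmetric] using nth_eq_iff_index_eq[OF d(1), of i j] d(4) ij by simp
    finally show "(mat n n (\<lambda>(i, j). if xs ! i = ys ! j then 1 else (0::real))
        * mat n n (\<lambda>(i, j). if ys ! i = xs ! j then 1 else (0::real))) $$ (i, j) = 1\<^sub>m n $$ (i, j)"
      using ij by (simp add: scalar_prod_def)
  qed auto
  have PQ: "P * Q = 1\<^sub>m n" and QP: "Q * P = 1\<^sub>m n"
    unfolding P_def Q_def
    using inv[OF vs ws eq n_def[symmetric] nw] inv[OF ws vs eq[symmetric] nw n_def[symmetric]]
    by simp_all
  have AP: "A * P = P * B"
  proof (rule eq_matI)
    fix i j assume "i < dim_row (P * B)" "j < dim_col (P * B)"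
    then have ij: "i < n" "j < n" using carr by auto
    obtain k where k: "k < n" "vs ! i = ws ! k" and ku: "\<And>l. l < n \<Longrightarrow> vs ! i = ws ! l \<Longrightarrow> l = k"
      using pick[of ws vs i] assms ij n_def nw by metis
    obtain m where m: "m < n" "ws ! j = vs ! m" and mu: "\<And>l. l < n \<Longrightarrow> ws ! j = vs ! l \<Longrightarrow> l = m"
      using pick[of vs ws j] assms ij n_def nw by metis
    have ek: "(vs ! i = ws ! l) = (l = k)" if "l < n" for l using that k ku by blast
    have em: "(vs ! l = ws ! j) = (l = m)" if "l < n" for l using that m mu by metis
    let ?a = "\<lambda>u v. if (u, v) \<in> parcs G then 1 else (0::real)"
    have "(A * P) $$ (i, j)
        = (\<Sum>l\<in>{0..<n}. ?a (vs ! i) (vs ! l) * (if vs ! l = ws ! j then 1 else 0))"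
      using ij by (simp add: A_def P_def adjacency_matrix_def n_def[symmetric] scalar_prod_def)
    also have "\<dots> = (\<Sum>l\<in>{0..<n}. ?a (vs ! i) (vs ! l) * (if l = m then 1 else 0))"
      by (rule sum.cong) (auto simp: em)
    also have "\<dots> = ?a (vs ! i) (ws ! j)"
      unfolding m(2) by (rule sum2[OF m(1)])
    also have "\<dots> = (\<Sum>l\<in>{0..<n}. (if l = k then 1 else 0) * ?a (ws ! l) (ws ! j))"
      unfolding k(2) by (rule sum1[OF k(1), symmetric])
    also have "\<dots> = (\<Sum>l\<in>{0..<n}. (if vs ! i = ws ! l then 1 else 0) * ?a (ws ! l) (ws ! j))"
      by (rule sum.cong) (auto simp: ek)
    also have "\<dots> = (P * B) $$ (i, j)"
      using ij by (simp add: B_def P_def adjacency_matrix_def nw scalar_prod_def)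
    finally show "(A * P) $$ (i, j) = (P * B) $$ (i, j)" .
  qed (use carr in auto)
  have cA: "A \<in> carrier_mat n n" and cP: "P \<in> carrier_mat n n" and cQ: "Q \<in> carrier_mat n n"
    using carr by auto
  have "A = A * (P * Q)"
    unfolding PQ right_mult_one_mat[OF cA] ..
  also have "\<dots> = P * B * Q"
    unfolding assoc_mult_mat[OF cA cP cQ, symmetric] AP ..
  finally have "similar_mat A B"
    using similar_matI[OF carr PQ QP] by blast
  then show ?thesis unfolding A_def B_def by (rule char_poly_similar)
qed

lemma eigenvalue_multiplicity_eq:
  assumes "distinct vs" "set vs = pverts G"
  shows "eigenvalue_multiplicity G x = Polynomial.order x (char_poly (adjacency_matrix G vs))"
proof -
  define ws where "ws = (SOME vs. distinct vs \<and> set vs = pverts G)"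
  have "distinct ws \<and> set ws = pverts G"
    unfolding ws_def by (rule someI[of _ vs]) (use assms in simp)
  then show ?thesis
    unfolding eigenvalue_multiplicity_def ws_def[symmetric] Let_def
    using char_poly_adjacency_matrix_cong[of ws vs G] assms by simp
qed

subsection \<open>The C-canonical graph\<close>

definition closed_neighborhood :: "'a pair_pre_digraph \<Rightarrow> 'a \<Rightarrow> 'a set" where
  "closed_neighborhood G v = {u. (v, u) \<in> parcs G} \<union> {v}"

definition rho :: "'a pair_pre_digraph \<Rightarrow> 'a rel" where
  "rho G = {(u, v). u \<in> pverts G \<and> v \<in> pverts G \<and>
              closed_neighborhood G u = closed_neighborhood G v}"

definition canonical_graph :: "'a pair_pre_digraph \<Rightarrow> 'a set pair_pre_digraph" where
  "canonical_graph G =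
     \<lparr> pverts = pverts G // rho G,
       parcs = {(C, D). C \<in> pverts G // rho G \<and> D \<in> pverts G // rho G \<and> C \<noteq> D \<and>
                  (\<exists>u\<in>C. \<exists>v\<in>D. (u, v) \<in> parcs G)} \<rparr>"

subsection \<open>Paths and the diamond construction\<close>

definition path_graph :: "nat \<Rightarrow> nat pair_pre_digraph" where
  "path_graph k =
     \<lparr> pverts = {..<k},
       parcs = {(i, j). i < k \<and> j < k \<and> (j = i + 1 \<or> i = j + 1)} \<rparr>"

(* The graph obtained from the path v_0 ... v_d, where Inl i is v_i and Inr j is the added vertex
   u_j. The set W of vertices of the path is given by its indices, and is intended to be contained
   in {..<d}. *)
definition path_diamond :: "nat \<Rightarrow> nat set \<Rightarrow> (nat + nat) pair_pre_digraph" where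
  "path_diamond d W =
     \<lparr> pverts = Inl ` pverts (path_graph (d + 1)) \<union> Inr ` W,
       parcs = {(Inl i, Inl j) |i j. (i, j) \<in> parcs (path_graph (d + 1))} \<union>
               (\<Union>j\<in>W. {(Inr j, Inl j), (Inl j, Inr j), (Inr j, Inl (j + 1)), (Inl (j + 1), Inr j)}) \<rparr>"

lemma pair_graph_canonical_graph:
  assumes "pair_graph G"
  shows "pair_graph (canonical_graph G)"
proof -
  interpret pair_graph G by fact
  have fin: "finite (pverts G // rho G)"
    by (rule finite_quotient) (auto simp: rho_def)
  have "parcs (canonical_graph G) \<subseteq> (pverts G // rho G) \<times> (pverts G // rho G)"
    by (auto simp: canonical_graph_def)
  then have "finite (parcs (canonical_graph G))"
    using fin by (meson finite_SigmaI finite_subset)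
  moreover have "symmetric (with_proj (canonical_graph G))"
    unfolding symmetric_def
    by (auto simp: canonical_graph_def sym_def dest: arcs_symmetric)
  ultimately show ?thesis
    using fin by unfold_locales (auto simp: canonical_graph_def)
qed

lemma pair_graph_path_graph: "pair_graph (path_graph k)"
proof -
  have "parcs (path_graph k) \<subseteq> {..<k} \<times> {..<k}"
    by (auto simp: path_graph_def)
  then have "finite (parcs (path_graph k))"
    by (meson finite_SigmaI finite_lessThan finite_subset)
  moreover have "symmetric (with_proj (path_graph k))"
    by (auto simp: symmetric_def path_graph_def sym_def)
  ultimately show ?thesis
    by unfold_locales (auto simp: path_graph_def)
qed

lemma pair_graph_path_diamond:
  assumes W: "W \<subseteq> {..<d}"
  shows "pair_graph (path_diamond d W)"
proof -
  have "finite W" using W finite_subset by blast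
  have wf: "parcs (path_diamond d W) \<subseteq> pverts (path_diamond d W) \<times> pverts (path_diamond d W)"
    using W by (auto simp: path_graph_def path_diamond_def)
  have fin: "finite (pverts (path_diamond d W))"
    using \<open>finite W\<close> by (simp add: path_diamond_def path_graph_def)
  then have "finite (parcs (path_diamond d W))"
    using wf by (meson finite_SigmaI finite_subset)
  moreover have "symmetric (with_proj (path_diamond d W))"
    by (auto simp: symmetric_def path_diamond_def path_graph_def sym_def)
  moreover have "fst e \<noteq> snd e" if "e \<in> parcs (path_diamond d W)" for e
    using that by (auto simp: path_diamond_def path_graph_def)
  ultimately show ?thesis
    using fin wf by unfold_locales auto
qed

end

theory Submission
  imports Defs "Jordan_Normal_Form.Jordan_Normal_Form_Uniqueness"
    "Jordan_Normal_Form.Jordan_Normal_Form_Existence"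
begin

text \<open>
  Let B = A + I, where A is the adjacency matrix. Row v of B is the indicator function of the closed
  neighborhood N[v], and since A is symmetric, the multiplicity of -1 is the dimension of the kernel
  of B. A vector in this kernel is a function on the vertices whose sum over every closed
  neighborhood is 0. The claim is therefore that B has rank d exactly for the listed graphs.

  A shortest path \<open>v\<^sub>0 \<dots> v\<^sub>d\<close> between two vertices at distance d is an induced path. A function
  c on a path whose closed sums vanish satisfies \<open>c\<^sub>0 + c\<^sub>1 = 0\<close> and \<open>c\<^sub>i + c\<^sub>i\<^sub>+\<^sub>1 + c\<^sub>i\<^sub>+\<^sub>2 = 0\<close>, so it
  is a multiple of the wave 1, -1, 0, 1, -1, 0, ..., and this wave can stop at the end of the path
  only if the number of vertices is 2 modulo 3. For every other number of vertices the principal block of B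
  on the path is nonsingular. Taking all d + 1 vertices, or only the first d of them when
  d = 1 modulo 3, shows that the rank is at least d and that equality forces d = 1 modulo 3. In that
  case (\<open>multiplicity_eq_iff_rows_suffice\<close>) equality holds if and only if the rows of
  \<open>v\<^sub>0, \<dots>, v\<^sub>d\<^sub>-\<^sub>1\<close> span the row space: a function whose closed sums vanish at these d vertices has
  vanishing closed sums everywhere.

  This criterion is applied to functions that live on the path and on one further vertex x.
  The path vertices in N[x] lie among three consecutive ones, as the path is a shortest one. The
  wave itself shows that its values on N[x] add up to 0; a wave that is switched on only after some
  index then excludes that N[x] meets the path in a single vertex or in two vertices at distance two.
  What remains (\<open>trace_cases\<close>) is that x meets the path like some path vertex, and then it is a
  twin of that vertex, or that it meets it exactly in \<open>v\<^sub>i\<close> and \<open>v\<^sub>i\<^sub>+\<^sub>1\<close> with i a multiple of 3 inside the path.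
  The switched-on wave also shows that two vertices of the second kind are adjacent if and only if
  they have the same i, in which case they are twins as well. After the identification of
  twins this is the graph \<open>P\<^sub>d\<^sub>+\<^sub>1 \<diamond> W\<close>. Conversely, in such a graph the same waves express every row of B
  by the rows of the path (\<open>structured_imp_rows_suffice\<close>). The conditions on i leave no room for W when
  d = 4, which gives the path with five vertices, and d = 1 gives the complete graphs.
\<close>

section \<open>Kernels of matrices and algebraic multiplicity\<close>

text \<open>
  If \<open>u = C v\<close> then \<open>\<langle>u, u\<rangle> = \<langle>v, C u\<rangle>\<close>, which is 0 when \<open>C u = 0\<close>.
\<close>

lemma hermitian_kernel_square:
  fixes C :: "complex mat"
  assumes C: "C \<in> carrier_mat n n"
    and herm: "\<And>i j. i < n \<Longrightarrow> j < n \<Longrightarrow> C $$ (j, i) = cnj (C $$ (i, j))"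
    and v: "v \<in> carrier_vec n" and z: "C *\<^sub>v (C *\<^sub>v v) = 0\<^sub>v n"
  shows "C *\<^sub>v v = 0\<^sub>v n"
proof -
  define u where "u = C *\<^sub>v v"
  have u: "u \<in> carrier_vec n" using C v by (simp add: u_def)
  have conj: "conjugate (C *\<^sub>v u) = transpose_mat C *\<^sub>v conjugate u"
  proof (rule eq_vecI)
    fix i assume "i < dim_vec (transpose_mat C *\<^sub>v conjugate u)"
    then have i: "i < n" using C by simp
    have "cnj (\<Sum>j = 0..<n. C $$ (i, j) * u $ j) = (\<Sum>j = 0..<n. C $$ (j, i) * cnj (u $ j))"
      unfolding cnj_sum by (rule sum.cong) (simp_all add: herm[OF i])
    then show "conjugate (C *\<^sub>v u) $ i = (transpose_mat C *\<^sub>v conjugate u) $ i"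
      using C u i by (simp add: scalar_prod_def)
  qed (use C u in simp)
  have "u \<bullet>c u = conjugate u \<bullet> (C *\<^sub>v v)"
    unfolding u_def[symmetric] by (rule comm_scalar_prod[of _ n]) (use u in auto)
  also have "\<dots> = (transpose_mat C *\<^sub>v conjugate u) \<bullet> v"
    by (rule transpose_vec_mult_scalar[symmetric, OF C v]) (use u in auto)
  also have "\<dots> = 0"
    unfolding conj[symmetric] using z v by (simp add: u_def)
  finally show ?thesis
    using conjugate_square_eq_0_vec[OF u] by (simp add: u_def)
qed

lemma hermitian_kernel_power:
  fixes C :: "complex mat"
  assumes C: "C \<in> carrier_mat n n"
    and herm: "\<And>i j. i < n \<Longrightarrow> j < n \<Longrightarrow> C $$ (j, i) = cnj (C $$ (i, j))"
  shows "mat_kernel (C ^\<^sub>m Suc k) = mat_kernel C"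
proof (induction k)
  case 0
  show ?case using C by simp
next
  case (Suc k)
  have pow: "C ^\<^sub>m m \<in> carrier_mat n n" for m using C by simp
  have step: "C ^\<^sub>m Suc m *\<^sub>v v = C ^\<^sub>m m *\<^sub>v (C *\<^sub>v v)" if "v \<in> carrier_vec n" for v m
    using assoc_mult_mat_vec[OF pow C that] by simp
  have "C ^\<^sub>m Suc (Suc k) *\<^sub>v v = 0\<^sub>v n \<longleftrightarrow> C *\<^sub>v v = 0\<^sub>v n" if v: "v \<in> carrier_vec n" for v
  proof -
    have Cv: "C *\<^sub>v v \<in> carrier_vec n" using C v by simp
    have "C ^\<^sub>m Suc (Suc k) *\<^sub>v v = 0\<^sub>v n \<longleftrightarrow> C ^\<^sub>m Suc k *\<^sub>v (C *\<^sub>v v) = 0\<^sub>v n"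
      unfolding step[OF v] ..
    also have "\<dots> \<longleftrightarrow> C *\<^sub>v (C *\<^sub>v v) = 0\<^sub>v n"
      using Suc.IH Cv unfolding mat_kernel[OF pow] mat_kernel[OF C] by blast
    also have "\<dots> \<longleftrightarrow> C *\<^sub>v v = 0\<^sub>v n"
      using hermitian_kernel_square[OF C herm v] C by auto
    finally show ?thesis .
  qed
  then show ?case unfolding mat_kernel[OF pow] mat_kernel[OF C] by blast
qed

text \<open>
  The algebraic multiplicity is the dimension of the kernel of a high power of the characteristic
  matrix; for a Hermitian matrix all powers have the same kernel.
\<close>

lemma hermitian_order_char_poly:
  fixes A :: "complex mat" and e :: real
  assumes A: "A \<in> carrier_mat n n"
    and herm: "\<And>i j. i < n \<Longrightarrow> j < n \<Longrightarrow> A $$ (j, i) = cnj (A $$ (i, j))"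
  shows "Polynomial.order (of_real e) (char_poly A) = kernel_dim (char_matrix A (of_real e))"
proof -
  let ?e = "complex_of_real e" and ?C = "char_matrix A (complex_of_real e)"
  have C: "?C \<in> carrier_mat n n" using A by (simp add: char_matrix_def)
  have hermC: "?C $$ (j, i) = cnj (?C $$ (i, j))" if "i < n" "j < n" for i j
    using that A herm[OF that] by (auto simp: char_matrix_def)
  obtain n_as where jnf: "jordan_nf A n_as"
    using char_poly_factorized[OF A] jordan_nf_exists[OF A] by blast
  let ?k = "Polynomial.order ?e (char_poly A)"
  let ?sizes = "map fst [(n, a)\<leftarrow>n_as. a = ?e]"
  have "?k = sum_list ?sizes"
    unfolding jordan_nf_order[OF jnf] by (simp add: case_prod_unfold)
  also have "\<dots> = (\<Sum>m\<leftarrow>?sizes. min (Suc ?k) m)"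
  proof -
    have "min (Suc ?k) m = m" if "m \<in> set ?sizes" for m
      using that jordan_nf_block_size_order_bound[OF jnf, of m ?e] by fastforce
    then show ?thesis using map_idI[of ?sizes "min (Suc ?k)"] by presburger
  qed
  also have "\<dots> = dim_gen_eigenspace A ?e (Suc ?k)"
    by (rule dim_gen_eigenspace[OF jnf, symmetric])
  also have "\<dots> = kernel_dim ?C"
  proof -
    have "mat_kernel (?C ^\<^sub>m Suc ?k) = mat_kernel ?C"
      using hermC by (rule hermitian_kernel_power[OF C])
    then show ?thesis
      unfolding dim_gen_eigenspace_def kernel_dim_def
      using pow_carrier_mat[OF C, of "Suc ?k"] C by (simp only: carrier_matD)
  qed
  finally show ?thesis .
qed

lemma kernel_dim_surjective:
  fixes M :: "'a :: field mat"
  assumes M: "M \<in> carrier_mat d n"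
    and surj: "\<And>y. y \<in> carrier_vec d \<Longrightarrow> \<exists>x\<in>carrier_vec n. M *\<^sub>v x = y"
  shows "kernel_dim M + d = n"
proof -
  interpret N: vec_space "TYPE('a)" n .
  interpret D: vec_space "TYPE('a)" d .
  interpret K: kernel d n M by unfold_locales (rule M)
  interpret T: linear_map class_ring N.V D.V "\<lambda>x. M *\<^sub>v x"
    using M by unfold_locales
      (auto simp: module_hom_def module_vec_simps class_ring_simps
        mult_add_distrib_mat_vec[OF M] mult_mat_vec[OF M])
  have im: "T.im = carrier_vec d"
    using M surj by (auto simp: T.im_def module_vec_simps)
  have ker: "T.ker = mat_kernel M"
    by (auto simp: T.ker_def mat_kernel[OF M] module_vec_simps)
  have "carrier_vec d = carrier D.V" by (simp add: module_vec_simps)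
  then have "D.V\<lparr>carrier := T.im\<rparr> = D.V" unfolding im by simp
  then show ?thesis
    using T.rank_nullity[OF N.fin_dim] unfolding ker K.kernel_dim
    by (simp add: N.dim_is_n D.dim_is_n)
qed

text \<open>
  A basis of the smaller kernel is independent in the larger one, and it is a basis there when the
  dimensions agree.
\<close>

lemma kernel_dim_subset:
  fixes A B :: "'a :: field mat"
  assumes A: "A \<in> carrier_mat m n" and B: "B \<in> carrier_mat d n"
    and sub: "mat_kernel B \<subseteq> mat_kernel A"
  shows "kernel_dim B \<le> kernel_dim A"
    and "kernel_dim B = kernel_dim A \<longleftrightarrow> mat_kernel A = mat_kernel B"
proof -
  interpret KA: kernel m n A by unfold_locales (rule A)
  interpret KB: kernel d n B by unfold_locales (rule B)
  obtain S where S: "finite S" "KB.basis S" using kernel_basis_exists[OF B] by blast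
  obtain S' where S': "finite S'" "KA.basis S'" using kernel_basis_exists[OF A] by blast
  have finA: "KA.Ker.fin_dim" using S' unfolding KA.Ker.fin_dim_def KA.Ker.basis_def by auto
  have SB: "S \<subseteq> mat_kernel B" and li: "KB.lin_indpt S" and span: "KB.span S = mat_kernel B"
    using S(2) unfolding KB.Ker.basis_def by auto
  have SA: "S \<subseteq> mat_kernel A" using SB sub by blast
  have liA: "KA.lin_indpt S" using li KA.lindep_same[OF SA] KB.lindep_same[OF SB] by blast
  have card: "kernel_dim B = card S" using KB.Ker.dim_basis[OF S] by simp
  show "kernel_dim B \<le> kernel_dim A"
    using KA.Ker.li_le_dim(2)[OF finA _ liA] SA card by simp
  show "kernel_dim B = kernel_dim A \<longleftrightarrow> mat_kernel A = mat_kernel B"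
  proof
    assume "kernel_dim B = kernel_dim A"
    then have "KA.basis S"
      using KA.Ker.dim_li_is_basis[OF finA S(1) _ liA] SA card by simp
    then have "KA.span S = mat_kernel A" unfolding KA.Ker.basis_def by auto
    then show "mat_kernel A = mat_kernel B"
      using span KA.span_same[OF SA] KB.span_same[OF SB] by simp
  next
    assume "mat_kernel A = mat_kernel B"
    then show "kernel_dim B = kernel_dim A"
      using A B by (simp only: kernel_dim_def carrier_matD)
  qed
qed

text \<open>
  When the leading block of size d is nonsingular, the first d rows form a matrix M whose kernel
  has dimension n - d. It contains the kernel of B, so B has nullity n - d exactly when the first d rows
  already cut out the kernel of B. The dimension n - d comes from surjectivity of M: a preimage is
  found by inverting the block and padding with zeros.
\<close>

lemma kernel_dim_nonsingular_block:
  fixes B :: "'a :: field mat"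
  assumes B: "B \<in> carrier_mat n n" and d: "d \<le> n"
    and nonsing: "\<And>x. x \<in> carrier_vec n \<Longrightarrow> (\<And>i. d \<le> i \<Longrightarrow> i < n \<Longrightarrow> x $ i = 0) \<Longrightarrow>
       (\<And>i. i < d \<Longrightarrow> (B *\<^sub>v x) $ i = 0) \<Longrightarrow> x = 0\<^sub>v n"
  shows "kernel_dim B + d \<le> n"
    and "kernel_dim B + d = n \<longleftrightarrow>
      (\<forall>x\<in>carrier_vec n. (\<forall>i<d. (B *\<^sub>v x) $ i = 0) \<longrightarrow> B *\<^sub>v x = 0\<^sub>v n)"
proof -
  define M where "M = mat d n (\<lambda>ij. B $$ ij)"
  define N where "N = mat d d (\<lambda>ij. B $$ ij)"
  have M: "M \<in> carrier_mat d n" and N: "N \<in> carrier_mat d d" by (auto simp: M_def N_def)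
  have Mx: "(M *\<^sub>v x) $ i = (B *\<^sub>v x) $ i" if "x \<in> carrier_vec n" "i < d" for x i
    using that B d by (simp add: M_def scalar_prod_def)
  (* extension of a vector on the block by zeros *)
  define pad where "pad x = vec n (\<lambda>i. if i < d then x $ i else 0)" for x :: "'a vec"
  have pad: "pad x \<in> carrier_vec n" for x by (simp add: pad_def)
  have Npad: "M *\<^sub>v pad x = N *\<^sub>v x" if x: "x \<in> carrier_vec d" for x
  proof (rule eq_vecI)
    fix i assume "i < dim_vec (N *\<^sub>v x)"
    then have i: "i < d" using N by simp
    have "(\<Sum>j = 0..<n. B $$ (i, j) * (if j < d then x $ j else 0)) = (\<Sum>j = 0..<d. B $$ (i, j) * x $ j)"
      using d by (intro sum.mono_neutral_cong_right) auto
    then show "(M *\<^sub>v pad x) $ i = (N *\<^sub>v x) $ i"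
      using i d x by (simp add: M_def N_def pad_def scalar_prod_def)
  qed (simp add: M_def N_def)
  have "det N \<noteq> 0"
  proof
    assume "det N = 0"
    then obtain x where x: "x \<in> carrier_vec d" "x \<noteq> 0\<^sub>v d" "N *\<^sub>v x = 0\<^sub>v d"
      using det_0_iff_vec_prod_zero_field[OF N] by blast
    have "pad x = 0\<^sub>v n"
    proof (rule nonsing[OF pad])
      show "(B *\<^sub>v pad x) $ i = 0" if "i < d" for i
        using Mx[OF pad that, of x] that x(3) by (simp add: Npad[OF x(1)])
    qed (simp add: pad_def)
    then have "x = 0\<^sub>v d"
      using x(1) d by (intro eq_vecI) (auto simp: pad_def vec_eq_iff split: if_splits)
    with x(2) show False ..
  qed
  then obtain N' where N': "N' \<in> carrier_mat d d" "N * N' = 1\<^sub>m d"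
    using det_non_zero_imp_unit[OF N, of "()"] by (auto simp: Units_def ring_mat_def)
  have dimM: "kernel_dim M + d = n"
  proof (rule kernel_dim_surjective[OF M])
    fix y :: "'a vec" assume y: "y \<in> carrier_vec d"
    have "M *\<^sub>v pad (N' *\<^sub>v y) = N *\<^sub>v (N' *\<^sub>v y)" using N' y by (intro Npad) auto
    also have "\<dots> = y" using assoc_mult_mat_vec[OF N N'(1) y] N'(2) y by simp
    finally show "\<exists>x\<in>carrier_vec n. M *\<^sub>v x = y" using pad by blast
  qed
  have kerM: "x \<in> mat_kernel M \<longleftrightarrow> x \<in> carrier_vec n \<and> (\<forall>i<d. (B *\<^sub>v x) $ i = 0)" for x
    using M Mx[of x] unfolding mat_kernel[OF M] by (auto simp: vec_eq_iff)
  have kerB: "x \<in> mat_kernel B \<longleftrightarrow> x \<in> carrier_vec n \<and> B *\<^sub>v x = 0\<^sub>v n" for x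
    unfolding mat_kernel[OF B] by simp
  have sub: "mat_kernel B \<subseteq> mat_kernel M"
    using d by (auto simp: kerM kerB)
  show "kernel_dim B + d \<le> n"
    using kernel_dim_subset(1)[OF M B sub] dimM by simp
  have "kernel_dim B + d = n \<longleftrightarrow> mat_kernel M \<subseteq> mat_kernel B"
    using kernel_dim_subset(2)[OF M B sub] dimM sub by auto
  then show "kernel_dim B + d = n \<longleftrightarrow>
      (\<forall>x\<in>carrier_vec n. (\<forall>i<d. (B *\<^sub>v x) $ i = 0) \<longrightarrow> B *\<^sub>v x = 0\<^sub>v n)"
    using kerM kerB by blast
qed

section \<open>The eigenvalue -1 and sums over closed neighborhoods\<close>

text \<open>
  The entry at v of the product of A + I with g.
\<close>

definition closed_sum :: "'a pair_pre_digraph \<Rightarrow> ('a \<Rightarrow> real) \<Rightarrow> 'a \<Rightarrow> real" where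
  "closed_sum G g v = (\<Sum>u\<in>closed_neighborhood G v. g u)"

lemma closed_neighborhood_subset:
  assumes "pair_graph G" "v \<in> pverts G"
  shows "closed_neighborhood G v \<subseteq> pverts G"
proof -
  interpret pair_graph G by fact
  show ?thesis using assms(2) in_arcsD2 unfolding closed_neighborhood_def by blast
qed

lemma closed_neighborhood_sym:
  assumes "pair_graph G"
  shows "u \<in> closed_neighborhood G v \<longleftrightarrow> v \<in> closed_neighborhood G u"
proof -
  interpret pair_graph G by fact
  show ?thesis unfolding closed_neighborhood_def using arcs_symmetric by blast
qed

lemma adjacency_char_matrix_mult:
  assumes G: "pair_graph G" and vs: "distinct vs" "set vs = pverts G"
    and x: "x \<in> carrier_vec (length vs)" and i: "i < length vs"
  shows "(char_matrix (map_mat complex_of_real (adjacency_matrix G vs)) (of_real (- 1)) *\<^sub>v x) $ i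
    = (\<Sum>j<length vs. of_bool (vs ! j \<in> closed_neighborhood G (vs ! i)) * x $ j)"
proof -
  interpret pair_graph G by fact
  have "(char_matrix (map_mat complex_of_real (adjacency_matrix G vs)) (of_real (- 1)) *\<^sub>v x) $ i
    = (\<Sum>j\<in>{0..<length vs}. (char_matrix (map_mat complex_of_real (adjacency_matrix G vs)) (of_real (- 1))) $$ (i, j) * x $ j)"
    using i x by (auto simp: scalar_prod_def char_matrix_def adjacency_matrix_def intro!: sum.cong)
  also have "\<dots> = (\<Sum>j\<in>{0..<length vs}. of_bool (vs ! j \<in> closed_neighborhood G (vs ! i)) * x $ j)"
    using i vs(1)
    by (intro sum.cong) (auto simp: char_matrix_def adjacency_matrix_def closed_neighborhood_def
      nth_eq_iff_index_eq dest: no_loops')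
  finally show ?thesis by (simp add: lessThan_atLeast0)
qed

lemma closed_sum_nth:
  assumes G: "pair_graph G" and vs: "distinct vs" "set vs = pverts G" and i: "i < length vs"
  shows "closed_sum G g (vs ! i)
    = (\<Sum>j<length vs. of_bool (vs ! j \<in> closed_neighborhood G (vs ! i)) * g (vs ! j))"
proof -
  have fin: "finite (pverts G)" using vs(2) by (metis List.finite_set)
  have "closed_neighborhood G (vs ! i) \<subseteq> pverts G"
    using i vs(2) nth_mem by (intro closed_neighborhood_subset[OF G]) blast
  then have "closed_sum G g (vs ! i)
      = (\<Sum>u\<in>pverts G. of_bool (u \<in> closed_neighborhood G (vs ! i)) * g u)"
    unfolding closed_sum_def using fin by (intro sum.mono_neutral_cong_left) auto
  also have "\<dots> = (\<Sum>j<length vs. of_bool (vs ! j \<in> closed_neighborhood G (vs ! i)) * g (vs ! j))"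
    by (rule sum.reindex_bij_betw[symmetric]) (use vs bij_betw_nth in blast)
  finally show ?thesis .
qed

lemma multiplicity_eq_kernel_dim:
  assumes G: "pair_graph G" and vs: "distinct vs" "set vs = pverts G"
  shows "eigenvalue_multiplicity G (- 1)
    = kernel_dim (char_matrix (map_mat complex_of_real (adjacency_matrix G vs)) (of_real (- 1)))"
proof -
  interpret pair_graph G by fact
  interpret h: map_poly_inj_idom_divide_hom complex_of_real by unfold_locales
  let ?A = "adjacency_matrix G vs" and ?n = "length vs"
  have A: "?A \<in> carrier_mat ?n ?n" by (simp add: adjacency_matrix_def)
  have sym: "map_mat complex_of_real ?A $$ (j, i) = cnj (map_mat complex_of_real ?A $$ (i, j))"
    if "i < ?n" "j < ?n" for i j
    using that by (auto simp: adjacency_matrix_def dest: arcs_symmetric)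
  have "eigenvalue_multiplicity G (- 1) = Polynomial.order (- 1) (char_poly ?A)"
    by (rule eigenvalue_multiplicity_eq[OF vs])
  also have "\<dots> = Polynomial.order (of_real (- 1)) (char_poly (map_mat complex_of_real ?A))"
    unfolding of_real_hom.char_poly_hom[OF A] h.order_hom ..
  also have "\<dots> = kernel_dim (char_matrix (map_mat complex_of_real ?A) (of_real (- 1)))"
    by (rule hermitian_order_char_poly[of _ ?n]) (use A sym in auto)
  finally show ?thesis .
qed

text \<open>
  The form of the rank criterion that the graph arguments use: Q indexes a nonsingular principal
  block of A + I, which gives rank at least |Q|, and the rank is |Q| exactly when the rows of Q
  determine the kernel. The multiplicity is computed over the complex numbers, where the
  characteristic polynomial splits; real and imaginary parts carry the criterion back to
  real functions.
\<close>

lemma multiplicity_minus_one: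
  assumes G: "pair_graph G" and Q: "Q \<subseteq> pverts G"
    and nonsing: "\<forall>f. (\<forall>x. x \<notin> Q \<longrightarrow> f x = 0) \<longrightarrow> (\<forall>q\<in>Q. closed_sum G f q = 0) \<longrightarrow> (\<forall>q\<in>Q. f q = 0)"
  shows "eigenvalue_multiplicity G (- 1) + card Q \<le> card (pverts G)"
    and "eigenvalue_multiplicity G (- 1) + card Q = card (pverts G) \<longleftrightarrow>
      (\<forall>g. (\<forall>q\<in>Q. closed_sum G g q = 0) \<longrightarrow> (\<forall>v\<in>pverts G. closed_sum G g v = 0))"
proof -
  interpret pair_graph G by fact
  have "finite Q" by (rule finite_subset[OF Q pair_finite_verts])
  then obtain qs where qs: "distinct qs" "set qs = Q" using finite_distinct_list by blast
  obtain rs where rs: "distinct rs" "set rs = pverts G - Q"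
    using finite_distinct_list[of "pverts G - Q"] pair_finite_verts by blast
  (* enumerate Q first, so that Q becomes the leading block *)
  define vs where "vs = qs @ rs"
  define n where "n = length vs"
  define d where "d = length qs"
  have vs: "distinct vs" "set vs = pverts G" using qs rs Q by (auto simp: vs_def)
  have cardV: "card (pverts G) = n" unfolding vs(2)[symmetric] n_def by (rule distinct_card[OF vs(1)])
  have cardQ: "card Q = d" unfolding qs(2)[symmetric] d_def by (rule distinct_card[OF qs(1)])
  have dn: "d \<le> n" by (simp add: d_def n_def vs_def)
  have nthV: "vs ! i \<in> pverts G" if "i < n" for i
    using nth_mem[of i vs] that unfolding vs(2) n_def .
  have nth: "\<exists>j<n. u = vs ! j" if "u \<in> pverts G" for u
    using that unfolding vs(2)[symmetric] n_def in_set_conv_nth by metis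
  have nthQ: "vs ! i \<in> Q \<longleftrightarrow> i < d" if "i < n" for i
  proof (cases "i < d")
    case True
    then have "vs ! i = qs ! i" by (simp add: vs_def d_def nth_append)
    moreover have "qs ! i \<in> Q" using True qs(2) d_def nth_mem by blast
    ultimately show ?thesis using True by simp
  next
    case False
    have len: "i - d < length rs" using False that by (simp add: vs_def d_def n_def)
    have "vs ! i = rs ! (i - d)" using False by (simp add: vs_def d_def nth_append)
    then have "vs ! i \<in> set rs" using nth_mem[OF len] by simp
    then show ?thesis using rs False by auto
  qed
  define B where "B = char_matrix (map_mat complex_of_real (adjacency_matrix G vs)) (of_real (- 1))"
  have B: "B \<in> carrier_mat n n" by (simp add: B_def char_matrix_def adjacency_matrix_def n_def)
  have kd: "eigenvalue_multiplicity G (- 1) = kernel_dim B"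
    unfolding B_def by (rule multiplicity_eq_kernel_dim[OF G vs])
  note Bx = adjacency_char_matrix_mult[OF G vs, folded n_def B_def]
  note ns = closed_sum_nth[OF G vs, folded n_def]
  define idx where "idx = the_inv_into {..<n} ((!) vs)"
  have idx: "idx (vs ! j) = j" if "j < n" for j
    unfolding idx_def using that vs(1)
    by (intro the_inv_into_f_f) (auto simp: inj_on_def n_def nth_eq_iff_index_eq)
  (* the real or imaginary part of a vector, read as a function on the vertices *)
  define part where "part h x u = (if u \<in> pverts G then h (x $ idx u) else (0::real))"
    for h :: "complex \<Rightarrow> real" and x u
  have part_nth: "part h x (vs ! j) = h (x $ j)" if "j < n" for h x j
    using nthV[OF that] idx[OF that] by (simp add: part_def)
  have part: "closed_sum G (part Re x) (vs ! i) = Re ((B *\<^sub>v x) $ i)"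
      "closed_sum G (part Im x) (vs ! i) = Im ((B *\<^sub>v x) $ i)" if "i < n" "x \<in> carrier_vec n" for x i
    unfolding ns[OF that(1)] Bx[OF that(2,1)] by (auto simp: part_nth intro!: sum.cong)
  have nonsing': "x = 0\<^sub>v n" if x: "x \<in> carrier_vec n" and supp: "\<And>i. d \<le> i \<Longrightarrow> i < n \<Longrightarrow> x $ i = 0"
    and ker: "\<And>i. i < d \<Longrightarrow> (B *\<^sub>v x) $ i = 0" for x
  proof -
    have *: "h (x $ i) = 0" if h: "h = Re \<or> h = Im" and i: "i < d" for h i
    proof -
      have i': "i < n" using i dn by simp
      have "part h x (vs ! i) = 0"
      proof (rule nonsing[rule_format])
        fix u assume u: "u \<notin> Q"
        show "part h x u = 0"
        proof (cases "u \<in> pverts G")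
          case True
          then obtain j where j: "j < n" "u = vs ! j" using nth by blast
          then have "x $ j = 0" using u nthQ[of j] supp[of j] by simp
          then show ?thesis using j part_nth h by auto
        qed (simp add: part_def)
      next
        fix q assume q: "q \<in> Q"
        then obtain j where j: "j < n" "q = vs ! j" using q Q nth by blast
        then have "j < d" using q nthQ by simp
        then show "closed_sum G (part h x) q = 0" using ker[of j] h part[OF j(1) x] j(2) by auto
      qed (use nthQ i i' in simp)
      then show ?thesis using part_nth[OF i'] by simp
    qed
    have "x $ i = 0" if "i < n" for i
    proof (cases "i < d")
      case True
      then show ?thesis using *[of Re i] *[of Im i] by (simp add: complex_eq_iff)
    qed (use supp that in simp)
    then show ?thesis using x by (intro eq_vecI) auto
  qed
  have "kernel_dim B + d \<le> n" using nonsing' by (rule kernel_dim_nonsingular_block(1)[OF B dn])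
  then show "eigenvalue_multiplicity G (- 1) + card Q \<le> card (pverts G)"
    by (simp add: kd cardQ cardV)
  have "kernel_dim B + d = n \<longleftrightarrow>
      (\<forall>x\<in>carrier_vec n. (\<forall>i<d. (B *\<^sub>v x) $ i = 0) \<longrightarrow> B *\<^sub>v x = 0\<^sub>v n)"
    using nonsing' by (rule kernel_dim_nonsingular_block(2)[OF B dn])
  also have "(\<forall>x\<in>carrier_vec n. (\<forall>i<d. (B *\<^sub>v x) $ i = 0) \<longrightarrow> B *\<^sub>v x = 0\<^sub>v n) \<longleftrightarrow>
      (\<forall>g. (\<forall>q\<in>Q. closed_sum G g q = 0) \<longrightarrow> (\<forall>v\<in>pverts G. closed_sum G g v = 0))" (is "?L \<longleftrightarrow> ?R")
  proof
    assume L: ?L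
    show ?R
    proof (intro allI impI ballI)
      fix g v assume g: "\<forall>q\<in>Q. closed_sum G g q = 0" and v: "v \<in> pverts G"
      define x where "x = vec n (\<lambda>j. complex_of_real (g (vs ! j)))"
      have x: "x \<in> carrier_vec n" by (simp add: x_def)
      have x_closed_sum: "(B *\<^sub>v x) $ i = complex_of_real (closed_sum G g (vs ! i))" if "i < n" for i
        unfolding ns[OF that] Bx[OF x that] by (simp add: x_def)
      have "B *\<^sub>v x = 0\<^sub>v n"
        using L x x_closed_sum g nthQ dn by simp
      moreover obtain j where "j < n" "v = vs ! j" using v nth by blast
      ultimately show "closed_sum G g v = 0" using x_closed_sum[of j] by simp
    qed
  next
    assume R: ?R
    show ?L
    proof (intro ballI impI)
      fix x :: "complex vec" assume x: "x \<in> carrier_vec n" and z: "\<forall>i<d. (B *\<^sub>v x) $ i = 0"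
      have "closed_sum G (part h x) q = 0" if h: "h = Re \<or> h = Im" and q: "q \<in> Q" for h q
      proof -
        obtain j where j: "j < n" "q = vs ! j" using q Q nth by blast
        then have "(B *\<^sub>v x) $ j = 0" using q nthQ z by simp
        then show ?thesis using h part[OF j(1) x] j(2) by auto
      qed
      then have "closed_sum G (part h x) v = 0" if "h = Re \<or> h = Im" "v \<in> pverts G" for h v
        using that R by blast
      then have "(B *\<^sub>v x) $ i = 0" if "i < n" for i
        using part[OF that x] nthV[OF that] by (simp add: complex_eq_iff)
      then show "B *\<^sub>v x = 0\<^sub>v n" using B by (intro eq_vecI) auto
    qed
  qed
  finally show "eigenvalue_multiplicity G (- 1) + card Q = card (pverts G) \<longleftrightarrow>
      (\<forall>g. (\<forall>q\<in>Q. closed_sum G g q = 0) \<longrightarrow> (\<forall>v\<in>pverts G. closed_sum G g v = 0))"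
    by (simp only: kd cardQ cardV)
qed

section \<open>Canonical graphs as images of collapsing maps\<close>

text \<open>
  An isomorphism of these digraphs carries separate data for arcs, heads and tails; for pair graphs
  it amounts to a bijection of the vertices that preserves adjacency in both directions.
\<close>

lemma digraph_iso_pair_graph_iff:
  assumes A: "pair_graph A" and B: "pair_graph B"
  shows "digraph_iso (with_proj A) (with_proj B) \<longleftrightarrow>
    (\<exists>f. bij_betw f (pverts A) (pverts B) \<and>
      (\<forall>u\<in>pverts A. \<forall>v\<in>pverts A. (u, v) \<in> parcs A \<longleftrightarrow> (f u, f v) \<in> parcs B))"
proof
  interpret A: pair_graph A by fact
  assume "digraph_iso (with_proj A) (with_proj B)"
  then obtain h where h: "pre_digraph.digraph_isomorphism (with_proj A) h"
    and eq: "with_proj B = app_iso h (with_proj A)"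
    unfolding digraph_iso_def by blast
  define f where "f = iso_verts h"
  have inj: "inj_on f (pverts A)"
    and ends: "\<And>a. a \<in> parcs A \<Longrightarrow> f (fst a) = iso_tail h (iso_arcs h a) \<and> f (snd a) = iso_head h (iso_arcs h a)"
    using h by (simp_all add: pre_digraph.digraph_isomorphism_def f_def)
  have V: "pverts B = f ` pverts A" and E: "parcs B = iso_arcs h ` parcs A"
    and t: "iso_tail h = fst" and hd: "iso_head h = snd"
    using arg_cong[OF eq, of verts] arg_cong[OF eq, of arcs] arg_cong[OF eq, of tail]
      arg_cong[OF eq, of head] by (simp_all add: f_def)
  have arc: "iso_arcs h a = (f (fst a), f (snd a))" if "a \<in> parcs A" for a
    using ends[OF that] by (simp add: t hd)
  have "(u, v) \<in> parcs A \<longleftrightarrow> (f u, f v) \<in> parcs B" if uv: "u \<in> pverts A" "v \<in> pverts A" for u v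
  proof
    assume "(u, v) \<in> parcs A"
    from arc[OF this] this show "(f u, f v) \<in> parcs B" unfolding E by force
  next
    assume "(f u, f v) \<in> parcs B"
    then obtain a b where ab: "(a, b) \<in> parcs A" "iso_arcs h (a, b) = (f u, f v)" unfolding E by auto
    then have "f a = f u" "f b = f v" using arc[OF ab(1)] by auto
    then have "a = u" "b = v"
      using inj uv A.in_arcsD1[OF ab(1)] A.in_arcsD2[OF ab(1)] by (auto dest: inj_onD)
    then show "(u, v) \<in> parcs A" using ab(1) by simp
  qed
  then show "\<exists>f. bij_betw f (pverts A) (pverts B) \<and>
      (\<forall>u\<in>pverts A. \<forall>v\<in>pverts A. (u, v) \<in> parcs A \<longleftrightarrow> (f u, f v) \<in> parcs B)"
    using inj V by (intro exI[of _ f]) (auto simp: bij_betw_def)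
next
  interpret A: pair_graph A by fact
  interpret B: pair_graph B by fact
  assume "\<exists>f. bij_betw f (pverts A) (pverts B) \<and>
      (\<forall>u\<in>pverts A. \<forall>v\<in>pverts A. (u, v) \<in> parcs A \<longleftrightarrow> (f u, f v) \<in> parcs B)"
  then obtain f where bij: "bij_betw f (pverts A) (pverts B)"
    and arcs: "\<And>u v. u \<in> pverts A \<Longrightarrow> v \<in> pverts A \<Longrightarrow> (u, v) \<in> parcs A \<longleftrightarrow> (f u, f v) \<in> parcs B"
    by blast
  define h where "h = \<lparr> iso_verts = f, iso_arcs = map_prod f f, iso_head = snd, iso_tail = fst \<rparr>"
  have inj: "inj_on f (pverts A)" and V: "f ` pverts A = pverts B" using bij by (auto simp: bij_betw_def)
  have sub: "parcs A \<subseteq> pverts A \<times> pverts A" using A.in_arcsD1 A.in_arcsD2 by auto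
  have E: "map_prod f f ` parcs A = parcs B"
  proof (intro equalityI subsetI)
    fix e assume "e \<in> map_prod f f ` parcs A"
    then show "e \<in> parcs B" using arcs sub by auto
  next
    fix e assume e: "e \<in> parcs B"
    then obtain p q where pq: "e = (p, q)" "p \<in> pverts B" "q \<in> pverts B"
      using B.in_arcsD1 B.in_arcsD2 by (cases e) blast
    then obtain u v where uv: "u \<in> pverts A" "v \<in> pverts A" "p = f u" "q = f v" using V by blast
    then have "(u, v) \<in> parcs A" using arcs e pq by blast
    then show "e \<in> map_prod f f ` parcs A" using pq(1) uv(3,4) by force
  qed
  have "pre_digraph.digraph_isomorphism (with_proj A) h"
    unfolding pre_digraph.digraph_isomorphism_def
  proof (intro conjI)
    show "inj_on (iso_arcs h) (arcs (with_proj A))"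
      using map_prod_inj_on[OF inj inj] sub by (auto simp: h_def intro: inj_on_subset)
  qed (use inj in \<open>auto simp: h_def A.wf_digraph_axioms\<close>)
  moreover have "with_proj B = app_iso h (with_proj A)"
    by (simp add: app_iso_def h_def V E with_proj_def)
  ultimately show "digraph_iso (with_proj A) (with_proj B)"
    unfolding digraph_iso_def by blast
qed

text \<open>
  Compatibility with closed neighborhoods, instead of adjacency, allows adjacent twins to have the
  same image: the quotient map onto the canonical graph is the typical example.
\<close>

definition collapse :: "'a pair_pre_digraph \<Rightarrow> 'b pair_pre_digraph \<Rightarrow> ('a \<Rightarrow> 'b) \<Rightarrow> bool" where
  "collapse G H t \<longleftrightarrow> t ` pverts G = pverts H \<and>
    (\<forall>x\<in>pverts G. \<forall>y\<in>pverts G.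
      y \<in> closed_neighborhood G x \<longleftrightarrow> t y \<in> closed_neighborhood H (t x))"

lemma equiv_rho: "equiv (pverts G) (rho G)"
  by (intro equivI) (auto simp: rho_def refl_on_def sym_def trans_def)

lemma rho_class_eq_iff:
  assumes "x \<in> pverts G" "y \<in> pverts G"
  shows "rho G `` {x} = rho G `` {y} \<longleftrightarrow> closed_neighborhood G x = closed_neighborhood G y"
  using eq_equiv_class_iff[OF equiv_rho assms] assms by (simp add: rho_def)

lemma pverts_canonical_graph: "pverts (canonical_graph G) = pverts G // rho G"
  by (simp add: canonical_graph_def)

lemma canonical_arc_iff:
  assumes G: "pair_graph G" and x: "x \<in> pverts G" and y: "y \<in> pverts G"
  shows "(rho G `` {x}, rho G `` {y}) \<in> parcs (canonical_graph G) \<longleftrightarrow>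
    y \<in> closed_neighborhood G x \<and> closed_neighborhood G x \<noteq> closed_neighborhood G y"
proof -
  interpret pair_graph G by fact
  note sym = closed_neighborhood_sym[OF G]
  have "rho G `` {x} \<in> pverts G // rho G" "rho G `` {y} \<in> pverts G // rho G"
    using x y by (auto simp: quotient_def)
  then have "(rho G `` {x}, rho G `` {y}) \<in> parcs (canonical_graph G) \<longleftrightarrow>
      closed_neighborhood G x \<noteq> closed_neighborhood G y \<and>
      (\<exists>u\<in>rho G `` {x}. \<exists>v\<in>rho G `` {y}. (u, v) \<in> parcs G)"
    using rho_class_eq_iff[OF x y] by (simp add: canonical_graph_def)
  also have "\<dots> \<longleftrightarrow> y \<in> closed_neighborhood G x \<and> closed_neighborhood G x \<noteq> closed_neighborhood G y"
  proof (intro iffI conjI; elim conjE bexE)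
    fix u v assume u: "u \<in> rho G `` {x}" and v: "v \<in> rho G `` {y}" and "(u, v) \<in> parcs G"
    then have "v \<in> closed_neighborhood G u" by (simp add: closed_neighborhood_def)
    then have "v \<in> closed_neighborhood G x" using u by (simp add: rho_def)
    then have "x \<in> closed_neighborhood G v" using sym by blast
    then have "x \<in> closed_neighborhood G y" using v by (simp add: rho_def)
    then show "y \<in> closed_neighborhood G x" using sym by blast
  next
    assume "y \<in> closed_neighborhood G x" "closed_neighborhood G x \<noteq> closed_neighborhood G y"
    then have "(x, y) \<in> parcs G" by (auto simp: closed_neighborhood_def)
    moreover have "x \<in> rho G `` {x}" "y \<in> rho G `` {y}" using x y by (auto simp: rho_def)
    ultimately show "\<exists>u\<in>rho G `` {x}. \<exists>v\<in>rho G `` {y}. (u, v) \<in> parcs G" by blast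
  qed
  finally show ?thesis .
qed

text \<open>
  The composition of the quotient map with the isomorphism.
\<close>

lemma canonical_iso_imp_collapse:
  assumes G: "pair_graph G" and H: "pair_graph H"
    and iso: "digraph_iso (with_proj (canonical_graph G)) (with_proj H)"
  obtains t where "collapse G H t"
proof -
  obtain f where bij: "bij_betw f (pverts G // rho G) (pverts H)"
    and arcs: "\<And>C D. C \<in> pverts G // rho G \<Longrightarrow> D \<in> pverts G // rho G \<Longrightarrow>
      (C, D) \<in> parcs (canonical_graph G) \<longleftrightarrow> (f C, f D) \<in> parcs H"
    using iso unfolding digraph_iso_pair_graph_iff[OF pair_graph_canonical_graph[OF G] H]
      pverts_canonical_graph by blast
  define t where "t x = f (rho G `` {x})" for x
  have cls: "rho G `` {x} \<in> pverts G // rho G" if "x \<in> pverts G" for x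
    using that by (auto simp: quotient_def)
  have "(\<lambda>x. rho G `` {x}) ` pverts G = pverts G // rho G" by (auto simp: quotient_def)
  then have "t ` pverts G = pverts H"
    using bij image_image[of f "\<lambda>x. rho G `` {x}" "pverts G"] unfolding t_def bij_betw_def by simp
  moreover have "y \<in> closed_neighborhood G x \<longleftrightarrow> t y \<in> closed_neighborhood H (t x)"
    if x: "x \<in> pverts G" and y: "y \<in> pverts G" for x y
  proof -
    have "t y = t x \<longleftrightarrow> rho G `` {x} = rho G `` {y}"
      unfolding t_def using bij cls[OF x] cls[OF y] by (auto simp: bij_betw_def inj_on_eq_iff)
    then have eq: "t y = t x \<longleftrightarrow> closed_neighborhood G x = closed_neighborhood G y"
      using rho_class_eq_iff[OF x y] by simp
    have "(t x, t y) \<in> parcs H \<longleftrightarrow>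
        y \<in> closed_neighborhood G x \<and> closed_neighborhood G x \<noteq> closed_neighborhood G y"
      using arcs[OF cls[OF x] cls[OF y]] canonical_arc_iff[OF G x y] by (simp add: t_def)
    moreover have "y \<in> closed_neighborhood G y" by (simp add: closed_neighborhood_def)
    ultimately show ?thesis using eq by (auto simp: closed_neighborhood_def[of H])
  qed
  ultimately show thesis using that unfolding collapse_def by blast
qed

text \<open>
  A collapsing map identifies only vertices with equal closed neighborhoods. If the image has
  no two vertices with the same closed neighborhood, it identifies all such pairs, so its fibers are the
  classes of the relation.
\<close>

lemma collapse_imp_canonical_iso:
  assumes G: "pair_graph G" and H: "pair_graph H" and t: "collapse G H t"
    and reduced: "\<And>a b. a \<in> pverts H \<Longrightarrow> b \<in> pverts H \<Longrightarrow>
      closed_neighborhood H a = closed_neighborhood H b \<Longrightarrow> a = b"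
  shows "digraph_iso (with_proj (canonical_graph G)) (with_proj H)"
proof -
  have onto: "t ` pverts G = pverts H"
    and nb: "\<And>x y. x \<in> pverts G \<Longrightarrow> y \<in> pverts G \<Longrightarrow>
      y \<in> closed_neighborhood G x \<longleftrightarrow> t y \<in> closed_neighborhood H (t x)"
    using t by (auto simp: collapse_def)
  have tV: "t x \<in> pverts H" if "x \<in> pverts G" for x using that onto by blast
  have twins: "closed_neighborhood G x = closed_neighborhood G y \<longleftrightarrow> t x = t y"
    if x: "x \<in> pverts G" and y: "y \<in> pverts G" for x y
  proof
    assume eq: "closed_neighborhood G x = closed_neighborhood G y"
    have "a \<in> closed_neighborhood H (t x) \<longleftrightarrow> a \<in> closed_neighborhood H (t y)" for a
    proof (cases "a \<in> pverts H")
      case True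
      then obtain z where "z \<in> pverts G" "a = t z" using onto by blast
      then show ?thesis using nb[OF x] nb[OF y] eq by blast
    next
      case False
      then show ?thesis
        using closed_neighborhood_subset[OF H tV[OF x]] closed_neighborhood_subset[OF H tV[OF y]] by blast
    qed
    then have "closed_neighborhood H (t x) = closed_neighborhood H (t y)" by blast
    then show "t x = t y" by (rule reduced[OF tV[OF x] tV[OF y]])
  next
    assume "t x = t y"
    then show "closed_neighborhood G x = closed_neighborhood G y"
      using nb[OF x] nb[OF y] closed_neighborhood_subset[OF G x] closed_neighborhood_subset[OF G y] by auto
  qed
  define f where "f C = t (SOME x. x \<in> C)" for C
  have f: "f (rho G `` {x}) = t x" if x: "x \<in> pverts G" for x
  proof -
    have "x \<in> rho G `` {x}" using x by (simp add: rho_def)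
    then have "(SOME z. z \<in> rho G `` {x}) \<in> rho G `` {x}" by (rule someI)
    then obtain z where z: "z = (SOME z. z \<in> rho G `` {x})" "z \<in> rho G `` {x}" by blast
    have zV: "z \<in> pverts G" and eq: "closed_neighborhood G x = closed_neighborhood G z"
      using z(2) by (simp_all add: rho_def)
    from eq have "t x = t z" unfolding twins[OF x zV] .
    then show ?thesis unfolding f_def z(1)[symmetric] by (rule sym)
  qed
  have classes: "pverts G // rho G = (\<lambda>x. rho G `` {x}) ` pverts G"
    by (auto simp: quotient_def)
  have "bij_betw f (pverts G // rho G) (pverts H)"
    unfolding bij_betw_def
  proof
    show "inj_on f (pverts G // rho G)"
    proof (rule inj_onI)
      fix C D assume "C \<in> pverts G // rho G" "D \<in> pverts G // rho G" and eq: "f C = f D"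
      then obtain x y where x: "x \<in> pverts G" "C = rho G `` {x}" and y: "y \<in> pverts G" "D = rho G `` {y}"
        unfolding classes by (elim imageE)
      have "t x = t y" using eq x y f by simp
      then show "C = D" unfolding x(2) y(2) rho_class_eq_iff[OF x(1) y(1)] twins[OF x(1) y(1)] .
    qed
    have "f ` (pverts G // rho G) = t ` pverts G"
      unfolding classes image_image using f by (rule image_cong[OF refl])
    then show "f ` (pverts G // rho G) = pverts H" using onto by simp
  qed
  moreover have "(C, D) \<in> parcs (canonical_graph G) \<longleftrightarrow> (f C, f D) \<in> parcs H"
    if C: "C \<in> pverts G // rho G" and D: "D \<in> pverts G // rho G" for C D
  proof -
    interpret H: pair_graph H by fact
    obtain x y where x: "x \<in> pverts G" "C = rho G `` {x}" and y: "y \<in> pverts G" "D = rho G `` {y}"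
      using C D unfolding classes by (elim imageE)
    have "(f C, f D) \<in> parcs H \<longleftrightarrow> t y \<in> closed_neighborhood H (t x) \<and> t x \<noteq> t y"
      using H.no_loops' by (auto simp: x y f closed_neighborhood_def)
    also have "\<dots> \<longleftrightarrow> (C, D) \<in> parcs (canonical_graph G)"
      using nb[OF x(1) y(1)] twins[OF x(1) y(1)] canonical_arc_iff[OF G x(1) y(1)] x(2) y(2) by simp
    finally show ?thesis by simp
  qed
  ultimately show ?thesis
    unfolding digraph_iso_pair_graph_iff[OF pair_graph_canonical_graph[OF G] H]
      pverts_canonical_graph by blast
qed

section \<open>Shortest paths and the wave of period three\<close>

definition wave :: "nat \<Rightarrow> real" where
  "wave j = (if j mod 3 = 0 then 1 else if j mod 3 = 1 then - 1 else 0)"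

lemma wave_add3: "wave j + wave (Suc j) + wave (Suc (Suc j)) = 0"
proof -
  have "j mod 3 = 0 \<or> j mod 3 = 1 \<or> j mod 3 = 2" by linarith
  then show ?thesis by (auto simp: wave_def mod_Suc)
qed

lemma wave_slot: "3 dvd i \<Longrightarrow> wave i = 1" "3 dvd i \<Longrightarrow> wave (Suc i) = - 1"
  by (simp_all add: wave_def mod_Suc dvd_eq_mod_eq_0)

lemma wave_zero_Suc: "wave i = 0 \<Longrightarrow> wave (Suc i) = 1"
  by (simp add: wave_def mod_Suc split: if_splits)

text \<open>
  Two consecutive values cancel only when the next one is 0, that is, for the pair 1, -1.
\<close>

lemma wave_cancel_Suc:
  assumes "wave i + wave (Suc i) = 0"
  shows "3 dvd i"
proof -
  have "wave (Suc (Suc i)) = 0" using assms wave_add3[of i] by simp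
  then have "wave (Suc (Suc (Suc i))) = 1" by (rule wave_zero_Suc)
  then have "Suc (Suc (Suc i)) mod 3 = 0" by (simp add: wave_def split: if_splits)
  then show ?thesis by presburger
qed

text \<open>
  Each equation determines a value from the two before it, and the wave satisfies the same equations.
\<close>

lemma path_recurrence:
  fixes c :: "nat \<Rightarrow> real"
  assumes "0 < m \<Longrightarrow> c 0 + c 1 = 0"
    and "\<And>i. Suc i < m \<Longrightarrow> c i + c (Suc i) + c (Suc (Suc i)) = 0"
  shows "j \<le> m \<Longrightarrow> c j = c 0 * wave j"
proof (induction j rule: less_induct)
  case (less j)
  consider "j = 0" | "j = 1" | i where "j = Suc (Suc i)"
    by (metis One_nat_def not0_implies_Suc)
  then show ?case
  proof cases
    case 2
    then show ?thesis using assms(1) less.prems by (simp add: wave_def)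
  next
    case 3
    have "c j = - c i - c (Suc i)" using assms(2)[of i] less.prems 3 by simp
    also have "\<dots> = c 0 * (- wave i - wave (Suc i))"
      using less.IH[of i] less.IH[of "Suc i"] less.prems 3 by (simp add: algebra_simps)
    also have "- wave i - wave (Suc i) = wave j" using wave_add3[of i] 3 by simp
    finally show ?thesis .
  qed (simp add: wave_def)
qed

text \<open>
  A path with a function on the vertices that changes by at most 1 along every arc and counts up along
  the path. Distance from an end vertex gives such a function for a shortest path, and in a diamond
  graph it can be read off from the indices. Its existence makes the path induced
  and lets every closed neighborhood meet it within three consecutive vertices.
\<close>

locale level_path =
  fixes G :: "'a pair_pre_digraph" and v :: "nat \<Rightarrow> 'a" and level :: "'a \<Rightarrow> nat" and d :: nat
  assumes graph: "pair_graph G"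
    and v_in: "\<And>i. i \<le> d \<Longrightarrow> v i \<in> pverts G"
    and level_v: "\<And>i. i \<le> d \<Longrightarrow> level (v i) = i"
    and v_step: "\<And>i. i < d \<Longrightarrow> (v i, v (Suc i)) \<in> parcs G"
    and level_arc: "\<And>x y. (x, y) \<in> parcs G \<Longrightarrow> level y \<le> Suc (level x)"
begin

abbreviation "V \<equiv> pverts G"
abbreviation "N \<equiv> closed_neighborhood G"

definition trace :: "'a \<Rightarrow> nat set" where
  "trace x = {i. i \<le> d \<and> v i \<in> N x}"

lemma finite_V: "finite V"
proof -
  interpret pair_graph G by (rule graph)
  show ?thesis by (rule pair_finite_verts)
qed

lemma finite_N: "x \<in> V \<Longrightarrow> finite (N x)"
  using closed_neighborhood_subset[OF graph] finite_V by (rule finite_subset)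

lemma N_sym: "x \<in> N y \<longleftrightarrow> y \<in> N x"
  by (rule closed_neighborhood_sym[OF graph])

lemma self_N: "x \<in> N x"
  by (simp add: closed_neighborhood_def)

lemma level_N:
  assumes "x \<in> N y"
  shows "level x \<le> Suc (level y)" "level y \<le> Suc (level x)"
proof -
  interpret pair_graph G by (rule graph)
  have "x = y \<or> (x, y) \<in> parcs G \<and> (y, x) \<in> parcs G"
    using assms arcs_symmetric by (auto simp: closed_neighborhood_def)
  then show "level x \<le> Suc (level y)" "level y \<le> Suc (level x)"
    using level_arc by auto
qed

lemma finite_trace: "finite (trace x)"
  by (simp add: trace_def)

lemma inj_v: "inj_on v {..d}"
  by (rule inj_on_inverseI[of _ level]) (simp add: level_v)

lemma v_N_iff:
  assumes i: "i \<le> d" and k: "k \<le> d"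
  shows "v i \<in> N (v k) \<longleftrightarrow> i \<le> Suc k \<and> k \<le> Suc i"
proof
  assume "v i \<in> N (v k)"
  then show "i \<le> Suc k \<and> k \<le> Suc i" using level_N[of "v i" "v k"] i k by (simp add: level_v)
next
  assume "i \<le> Suc k \<and> k \<le> Suc i"
  then consider "i = k" | "i = Suc k" | "k = Suc i" by linarith
  then show "v i \<in> N (v k)"
  proof cases
    case 1
    then show ?thesis by (simp add: self_N)
  next
    case 2
    then show ?thesis using v_step[of k] i by (simp add: closed_neighborhood_def)
  next
    case 3
    then have "v k \<in> N (v i)" using v_step[of i] k by (simp add: closed_neighborhood_def)
    then show ?thesis using N_sym by simp
  qed
qed

lemma trace_v: "k \<le> d \<Longrightarrow> trace (v k) = {i. i \<le> d \<and> i \<le> Suc k \<and> k \<le> Suc i}"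
  using v_N_iff by (auto simp: trace_def)

lemma trace_iff: "i \<le> d \<Longrightarrow> i \<in> trace x \<longleftrightarrow> x \<in> N (v i)"
  using N_sym by (simp add: trace_def)

lemma trace_close:
  assumes "i \<in> trace x" "j \<in> trace x"
  shows "i \<le> j + 2"
  using assms level_N[of "v i" x] level_N[of "v j" x] by (simp add: trace_def level_v)

lemma sum_trace_v:
  fixes c :: "nat \<Rightarrow> real"
  assumes k: "k \<le> d"
  shows "sum c (trace (v k)) =
    (if k = 0 then 0 else c (k - 1)) + c k + (if k < d then c (Suc k) else 0)"
proof -
  have "trace (v k) = (if k = 0 then {} else {k - 1}) \<union> {k} \<union> (if k < d then {Suc k} else {})"
    unfolding trace_v[OF k] using k by auto
  also have "sum c \<dots> = (if k = 0 then 0 else c (k - 1)) + c k + (if k < d then c (Suc k) else 0)"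
    by (auto simp: sum.union_disjoint)
  finally show ?thesis .
qed

definition on_path :: "(nat \<Rightarrow> real) \<Rightarrow> 'a \<Rightarrow> real" where
  "on_path c x = (if level x \<le> d \<and> v (level x) = x then c (level x) else 0)"

lemma on_path_v: "i \<le> d \<Longrightarrow> on_path c (v i) = c i"
  by (simp add: on_path_def level_v)

lemma closed_sum_on_path:
  assumes x: "x \<in> V"
  shows "closed_sum G (on_path c) x = sum c (trace x)"
proof -
  have "v ` trace x \<subseteq> N x" by (auto simp: trace_def)
  moreover have "on_path c y = 0" if "y \<in> N x - v ` trace x" for y
  proof -
    have "\<not> (level y \<le> d \<and> v (level y) = y)"
    proof
      assume y: "level y \<le> d \<and> v (level y) = y"
      then have "level y \<in> trace x" using that by (simp add: trace_def)
      then have "v (level y) \<in> v ` trace x" by (rule imageI)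
      then show False using y that by simp
    qed
    then show ?thesis by (auto simp: on_path_def)
  qed
  ultimately have "closed_sum G (on_path c) x = sum (on_path c) (v ` trace x)"
    unfolding closed_sum_def using finite_N[OF x] by (intro sum.mono_neutral_right) auto
  also have "\<dots> = sum (on_path c \<circ> v) (trace x)"
    by (rule sum.reindex) (rule inj_on_subset[OF inj_v], auto simp: trace_def)
  also have "\<dots> = sum c (trace x)"
    by (rule sum.cong) (auto simp: trace_def on_path_v)
  finally show ?thesis .
qed

text \<open>
  The symmetry of A + I: the pairing of c with B g equals the pairing of B c with g.
\<close>

lemma sum_trace_swap:
  "(\<Sum>j\<le>d. c j * closed_sum G g (v j)) = (\<Sum>z\<in>V. g z * sum c (trace z))"
proof -
  have "closed_sum G g (v j) = (\<Sum>z\<in>V. of_bool (z \<in> N (v j)) * g z)" if "j \<le> d" for j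
    unfolding closed_sum_def using closed_neighborhood_subset[OF graph v_in[OF that]] finite_V
    by (intro sum.mono_neutral_cong_left) auto
  then have "(\<Sum>j\<le>d. c j * closed_sum G g (v j)) = (\<Sum>j\<le>d. \<Sum>z\<in>V. g z * (of_bool (j \<in> trace z) * c j))"
    by (auto intro!: sum.cong simp: sum_distrib_left trace_iff)
  also have "\<dots> = (\<Sum>z\<in>V. \<Sum>j\<le>d. g z * (of_bool (j \<in> trace z) * c j))" by (rule sum.swap)
  also have "\<dots> = (\<Sum>z\<in>V. g z * sum c (trace z))"
  proof (rule sum.cong)
    fix z
    have "(\<Sum>j\<le>d. of_bool (j \<in> trace z) * c j) = sum c (trace z)"
      by (rule sum.mono_neutral_cong_right) (auto simp: trace_def)
    then show "(\<Sum>j\<le>d. g z * (of_bool (j \<in> trace z) * c j)) = g z * sum c (trace z)"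
      by (simp flip: sum_distrib_left)
  qed simp
  finally show ?thesis .
qed

text \<open>
  A function supported on the first m path vertices is a multiple of the wave and vanishes at index m,
  where the wave is nonzero.
\<close>

lemma path_nonsingular:
  assumes m: "m \<le> Suc d" "m mod 3 \<noteq> 2"
    and supp: "\<And>x. x \<notin> v ` {..<m} \<Longrightarrow> f x = 0"
    and ker: "\<And>q. q \<in> v ` {..<m} \<Longrightarrow> closed_sum G f q = 0"
    and q: "q \<in> v ` {..<m}"
  shows "f q = 0"
proof -
  define c where "c i = (if i < m then f (v i) else 0)" for i
  have "f x = on_path c x" for x
  proof (cases "level x < m \<and> v (level x) = x")
    case True
    then show ?thesis using m(1) by (simp add: on_path_def c_def)
  next
    case False
    have "x \<notin> v ` {..<m}"
    proof
      assume "x \<in> v ` {..<m}"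
      then obtain i where "i < m" "x = v i" by blast
      then show False using False m(1) level_v[of i] by simp
    qed
    then have "f x = 0" by (rule supp)
    moreover have "on_path c x = 0" using False by (simp add: on_path_def c_def)
    ultimately show ?thesis by simp
  qed
  then have f: "f = on_path c" by (rule ext)
  have row: "sum c (trace (v i)) = 0" if "i < m" for i
    using ker[of "v i"] that m(1) closed_sum_on_path[OF v_in, of i c] f by simp
  have c_end: "c (Suc i) = 0" if "d \<le> i" for i using that m(1) by (simp add: c_def)
  have rec: "c j = c 0 * wave j" if "j \<le> m" for j
  proof (rule path_recurrence[OF _ _ that])
    assume "0 < m"
    then show "c 0 + c 1 = 0" using row[of 0] c_end[of 0] sum_trace_v[of 0 c] by (cases "d = 0") simp_all
  next
    fix i assume i: "Suc i < m"
    then show "c i + c (Suc i) + c (Suc (Suc i)) = 0"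
      using row[of "Suc i"] c_end[of "Suc i"] sum_trace_v[of "Suc i" c] m(1)
      by (cases "Suc i < d") simp_all
  qed
  have "wave m \<noteq> 0" using m(2) by (simp add: wave_def) linarith
  moreover have "c 0 * wave m = 0" using rec[of m] by (simp add: c_def)
  ultimately have "c 0 = 0" by simp
  obtain i where "i < m" "q = v i" using q by blast
  then show ?thesis using rec[of i] \<open>c 0 = 0\<close> by (simp add: c_def)
qed

text \<open>
  The rows of A + I at the first d path vertices span the row space, expressed through kernels.
\<close>

definition rows_suffice :: bool where
  "rows_suffice \<longleftrightarrow> (\<forall>g. (\<forall>i<d. closed_sum G g (v i) = 0) \<longrightarrow> (\<forall>x\<in>V. closed_sum G g x = 0))"

lemma card_v: "m \<le> Suc d \<Longrightarrow> card (v ` {..<m}) = m"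
  by (subst card_image) (auto intro: inj_on_subset[OF inj_v])

lemma v_subset: "m \<le> Suc d \<Longrightarrow> v ` {..<m} \<subseteq> V"
  using v_in by auto

lemma multiplicity_bound_mod:
  assumes "m \<le> Suc d" "m mod 3 \<noteq> 2"
  shows "eigenvalue_multiplicity G (- 1) + m \<le> card V"
    and "eigenvalue_multiplicity G (- 1) + m = card V \<longleftrightarrow>
      (\<forall>g. (\<forall>i<m. closed_sum G g (v i) = 0) \<longrightarrow> (\<forall>x\<in>V. closed_sum G g x = 0))"
proof -
  have nonsing: "\<forall>f. (\<forall>x. x \<notin> v ` {..<m} \<longrightarrow> f x = 0) \<longrightarrow>
      (\<forall>q\<in>v ` {..<m}. closed_sum G f q = 0) \<longrightarrow> (\<forall>q\<in>v ` {..<m}. f q = 0)"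
    using path_nonsingular[OF assms] by blast
  note main = multiplicity_minus_one[OF graph v_subset[OF assms(1)] nonsing]
  show "eigenvalue_multiplicity G (- 1) + m \<le> card V"
    using main(1) by (simp only: card_v[OF assms(1)])
  have image: "(\<forall>q\<in>v ` {..<m}. closed_sum G g q = 0) \<longleftrightarrow> (\<forall>i<m. closed_sum G g (v i) = 0)" for g
    by auto
  show "eigenvalue_multiplicity G (- 1) + m = card V \<longleftrightarrow>
      (\<forall>g. (\<forall>i<m. closed_sum G g (v i) = 0) \<longrightarrow> (\<forall>x\<in>V. closed_sum G g x = 0))"
    using main(2) unfolding card_v[OF assms(1)] by (simp only: image)
qed

text \<open>
  For d not 1 modulo 3 the block on all d + 1 path vertices is nonsingular and the bound is strict.
\<close>

lemma multiplicity_bound: "eigenvalue_multiplicity G (- 1) + d \<le> card V"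
  and multiplicity_eq_imp_mod: "eigenvalue_multiplicity G (- 1) + d = card V \<Longrightarrow> d mod 3 = 1"
proof -
  have *: "eigenvalue_multiplicity G (- 1) + Suc d \<le> card V" if "d mod 3 \<noteq> 1"
    using that by (intro multiplicity_bound_mod) (auto simp: mod_Suc)
  show "eigenvalue_multiplicity G (- 1) + d = card V \<Longrightarrow> d mod 3 = 1"
    using * by linarith
  show "eigenvalue_multiplicity G (- 1) + d \<le> card V"
    using * multiplicity_bound_mod(1)[of d] by fastforce
qed

lemma multiplicity_eq_iff_rows_suffice:
  assumes "d mod 3 = 1"
  shows "eigenvalue_multiplicity G (- 1) + d = card V \<longleftrightarrow> rows_suffice"
  unfolding rows_suffice_def using assms by (intro multiplicity_bound_mod) auto

end

section \<open>Vertices off the path\<close>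

definition tail_wave :: "nat \<Rightarrow> nat \<Rightarrow> real" where
  "tail_wave i j = (if i < j then wave j else 0)"

text \<open>
  For d = 1 modulo 3 these are the multiples of 3 below d other than 0 and d - 1. At those two the added
  vertex would be a twin of an end vertex of the path.
\<close>

definition diamond_slots :: "nat \<Rightarrow> nat set" where
  "diamond_slots d = {j. 3 dvd j \<and> 3 \<le> j \<and> j \<le> d - 4}"

locale wave_path = level_path +
  assumes d_mod: "d mod 3 = 1"
begin

lemma wave_d: "wave d = - 1" "wave (Suc d) = 0"
  using d_mod by (simp_all add: wave_def mod_Suc)

lemma sum_wave_v:
  assumes k: "k \<le> d"
  shows "sum wave (trace (v k)) = 0"
proof (cases k)
  case 0
  have "d \<noteq> 0" using d_mod by auto
  then show ?thesis using sum_trace_v[OF k, of wave] 0 by (simp add: wave_def)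
next
  case (Suc l)
  then show ?thesis using sum_trace_v[OF k, of wave] wave_add3[of l] wave_d(2) k
    by (cases "k = d") simp_all
qed

text \<open>
  Away from i the terms of a closed sum are three consecutive values of the wave, or all of them are 0.
  At the far end of the path the missing third term is the value 0 of the wave at d + 1.
\<close>

lemma sum_tail_wave_v:
  assumes i: "i < d" and k: "k \<le> d"
  shows "sum (tail_wave i) (trace (v k)) =
    (if k = i then wave (Suc i) else if k = Suc i then - wave i else 0)"
proof (cases k)
  case 0
  then show ?thesis using sum_trace_v[OF k, of "tail_wave i"] i by (simp add: tail_wave_def)
next
  case (Suc l)
  have "sum (tail_wave i) (trace (v k)) = tail_wave i l + tail_wave i (Suc l) + tail_wave i (Suc (Suc l))"
    using sum_trace_v[OF k, of "tail_wave i"] wave_d(2) k Suc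
    by (cases "k = d") (simp_all add: tail_wave_def)
  then show ?thesis using wave_add3[of l] Suc by (auto simp: tail_wave_def)
qed

text \<open>
  The function is a at x plus c on the path. Its closed sums at path vertices are the values in the
  hypothesis, so its closed sum vanishes at every vertex y.
\<close>

lemma test_function:
  fixes a :: real and c :: "nat \<Rightarrow> real"
  assumes ext: rows_suffice and x: "x \<in> V" and y: "y \<in> V"
    and ker: "\<And>i. i < d \<Longrightarrow> a * of_bool (i \<in> trace x) + sum c (trace (v i)) = 0"
  shows "a * of_bool (x \<in> N y) + sum c (trace y) = 0"
proof -
  define g where "g z = a * of_bool (z = x) + on_path c z" for z
  have ns: "closed_sum G g z = a * of_bool (x \<in> N z) + sum c (trace z)" if z: "z \<in> V" for z
  proof -
    have "closed_sum G g z = a * (\<Sum>u\<in>N z. of_bool (u = x)) + closed_sum G (on_path c) z"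
      by (simp add: closed_sum_def g_def sum.distrib sum_distrib_left)
    also have "(\<Sum>u\<in>N z. of_bool (u = x)) = (of_bool (x \<in> N z) :: real)"
      using finite_N[OF z] by (simp add: of_bool_def sum.If_cases)
    finally show ?thesis using closed_sum_on_path[OF z] by simp
  qed
  have "closed_sum G g (v i) = 0" if "i < d" for i
    using ns[of "v i"] v_in[of i] ker[OF that] trace_iff[of i x] that by simp
  then have "closed_sum G g y = 0" using ext y unfolding rows_suffice_def by blast
  then show ?thesis using ns[OF y] by simp
qed

text \<open>
  The difference of the indicator functions of x and y has vanishing closed sums on the path.
\<close>

lemma same_trace_twins:
  assumes ext: rows_suffice and x: "x \<in> V" and y: "y \<in> V" and eq: "trace x = trace y"
  shows "N x = N y"
proof -
  define g where "g z = of_bool (z = x) - (of_bool (z = y) :: real)" for z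
  have ns: "closed_sum G g z = of_bool (x \<in> N z) - of_bool (y \<in> N z)" if z: "z \<in> V" for z
    using finite_N[OF z] by (simp add: closed_sum_def g_def sum_subtractf of_bool_def sum.If_cases)
  have "closed_sum G g (v i) = 0" if "i < d" for i
    using ns[of "v i"] v_in[of i] trace_iff[of i x] trace_iff[of i y] eq that by simp
  then have 0: "closed_sum G g z = 0" if "z \<in> V" for z using ext that unfolding rows_suffice_def by blast
  have "z \<in> N x \<longleftrightarrow> z \<in> N y" if "z \<in> V" for z
    using ns[OF that] 0[OF that] N_sym[of z x] N_sym[of z y] by (auto simp: of_bool_def split: if_splits)
  then show ?thesis
    using closed_neighborhood_subset[OF graph x] closed_neighborhood_subset[OF graph y] by auto
qed

lemma trace_nonempty:
  assumes ext: rows_suffice and x: "x \<in> V"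
  shows "trace x \<noteq> {}"
proof
  assume "trace x = {}"
  then show False using test_function[OF ext x x, of 1 "\<lambda>_. 0"] self_N[of x] by simp
qed

lemma sum_wave_zero:
  assumes ext: rows_suffice and x: "x \<in> V"
  shows "sum wave (trace x) = 0"
  using test_function[OF ext x x, of 0 wave] sum_wave_v by simp

text \<open>
  The wave must vanish at i. Then the negative of the wave switched on after i compensates x on the
  path, but the closed sum at x is 1.
\<close>

lemma trace_not_singleton:
  assumes ext: rows_suffice and x: "x \<in> V"
  shows "trace x \<noteq> {i}"
proof
  assume tr: "trace x = {i}"
  have "wave i = 0" using sum_wave_zero[OF ext x] tr by simp
  then have "wave (Suc i) = 1" by (rule wave_zero_Suc)
  have "i \<le> d" using tr by (auto simp: trace_def)
  moreover have "i \<noteq> d" using wave_d \<open>wave i = 0\<close> by auto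
  ultimately have i: "i < d" by simp
  have "1 * of_bool (x \<in> N x) + sum (\<lambda>j. - tail_wave i j) (trace x) = 0"
    using sum_tail_wave_v[OF i] \<open>wave i = 0\<close> \<open>wave (Suc i) = 1\<close>
    by (intro test_function[OF ext x x]) (simp add: tr sum_negf)
  then show False using tr by (simp add: tail_wave_def self_N)
qed

text \<open>
  The trace is that of the vertex with index i + 1 with this vertex removed. Subtracting that vertex and adding the
  wave switched on after it makes all closed sums on the path vanish, but the closed sum at x is 2.
\<close>

lemma trace_no_gap:
  assumes ext: rows_suffice and x: "x \<in> V"
  shows "trace x \<noteq> {i, i + 2}"
proof
  assume tr: "trace x = {i, i + 2}"
  have w: "wave i + wave (Suc (Suc i)) = 0" using sum_wave_zero[OF ext x] tr by simp
  then have w1: "wave (Suc i) = 0" using wave_add3[of i] by simp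
  then have w2: "wave (Suc (Suc i)) = 1" by (rule wave_zero_Suc)
  have "i + 2 \<in> trace x" using tr by simp
  then have i: "Suc i < d" by (simp add: trace_def)
  define c where "c j = tail_wave (Suc i) j - of_bool (j = Suc i)" for j
  have sum_c: "sum c (trace z) = sum (tail_wave (Suc i)) (trace z) - of_bool (Suc i \<in> trace z)" for z
    using finite_trace[of z] by (simp add: c_def sum_subtractf of_bool_def sum.If_cases)
  have "1 * of_bool (x \<in> N x) + sum c (trace x) = 0"
  proof (rule test_function[OF ext x x])
    fix k assume k: "k < d"
    then have "Suc i \<in> trace (v k) \<longleftrightarrow> k = i \<or> k = Suc i \<or> k = i + 2"
      using i by (auto simp: trace_v)
    then show "1 * of_bool (k \<in> trace x) + sum c (trace (v k)) = 0"
      using sum_tail_wave_v[OF i, of k] k w1 w2 by (auto simp: sum_c tr)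
  qed
  then show False using w2 by (simp add: c_def tr tail_wave_def self_N)
qed

abbreviation "slots \<equiv> diamond_slots d"

lemma slots_less: "i \<in> slots \<Longrightarrow> Suc i < d"
  by (auto simp: diamond_slots_def)

text \<open>
  Among the nonempty subsets of three consecutive indices, the full set is the trace of the middle vertex, and a pair of
  neighbors starts at a multiple of 3 because the wave sums to 0 over it. At the two ends of the path such a pair is
  the trace of the end vertex.
\<close>

lemma trace_cases:
  assumes ext: rows_suffice and x: "x \<in> V"
  shows "(\<exists>k\<le>d. N x = N (v k)) \<or> (\<exists>i\<in>slots. trace x = {i, Suc i})"
proof -
  define i where "i = Min (trace x)"
  have i: "i \<in> trace x" and min: "\<And>j. j \<in> trace x \<Longrightarrow> i \<le> j"
    using trace_nonempty[OF ext x] finite_trace[of x] by (simp_all add: i_def)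
  have le: "j \<le> d" if "j \<in> trace x" for j using that by (simp add: trace_def)
  have sub: "trace x \<subseteq> {i, Suc i, i + 2}"
  proof
    fix j assume "j \<in> trace x"
    then have "i \<le> j" "j \<le> i + 2" using min trace_close i by auto
    then show "j \<in> {i, Suc i, i + 2}" by auto
  qed
  have twin: "\<exists>k\<le>d. N x = N (v k)" if "k \<le> d" "trace x = trace (v k)" for k
    using same_trace_twins[OF ext x v_in[OF that(1)] that(2)] that(1) by auto
  consider (three) "trace x = {i, Suc i, i + 2}" | (two) "trace x = {i, Suc i}"
    using sub i trace_not_singleton[OF ext x, of i] trace_no_gap[OF ext x, of i] by blast
  then show ?thesis
  proof cases
    case three
    then have "Suc i < d" using le[of "i + 2"] by simp
    then have "trace x = trace (v (Suc i))" unfolding three by (auto simp: trace_v)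
    then show ?thesis using twin[of "Suc i"] \<open>Suc i < d\<close> by simp
  next
    case two
    then have i_d: "Suc i \<le> d" using le[of "Suc i"] by simp
    have "wave i + wave (Suc i) = 0" using sum_wave_zero[OF ext x] two by simp
    then have i3: "3 dvd i" by (rule wave_cancel_Suc)
    consider "i = 0" | "Suc i = d" | "i \<noteq> 0" "Suc i \<noteq> d" by blast
    then show ?thesis
    proof cases
      case 1
      then have "trace x = trace (v 0)" unfolding two using i_d by (auto simp: trace_v)
      then show ?thesis using twin[of 0] by simp
    next
      case 2
      then have "trace x = trace (v d)" unfolding two by (auto simp: trace_v)
      then show ?thesis using twin[of d] by simp
    next
      case 3
      have "3 \<le> i" using i3 3(1) by presburger
      moreover have "i \<le> d - 4" using i3 i_d 3(2) d_mod by presburger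
      ultimately have "i \<in> slots" using i3 unfolding diamond_slots_def by simp
      then show ?thesis using two by blast
    qed
  qed
qed

lemma diamond_sum:
  assumes i: "i \<in> slots" and k: "k \<le> d"
  shows "of_bool (k \<in> {i, Suc i}) + sum (tail_wave i) (trace (v k)) = 0"
proof -
  have "wave i = 1" "wave (Suc i) = - 1"
    using i wave_slot[of i] by (simp_all add: diamond_slots_def)
  then show ?thesis using sum_tail_wave_v[of i k] slots_less[OF i] k by auto
qed

lemma diamond_sum_slot:
  assumes i: "i \<in> slots" and j: "j \<in> slots"
  shows "of_bool (i = j) + sum (tail_wave i) {j, Suc j} = 0"
proof -
  have "3 dvd i" "3 dvd j" using i j by (auto simp: diamond_slots_def)
  then have "i = j \<or> Suc i < j \<or> Suc j < i" by presburger
  moreover have "wave j = 1" "wave (Suc j) = - 1"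
    using j wave_slot[of j] by (simp_all add: diamond_slots_def)
  ultimately show ?thesis by (auto simp: tail_wave_def)
qed

text \<open>
  The indicator of x plus the wave switched on after i is in the kernel; its closed sum at y compares
  i with j.
\<close>

lemma slots_adjacent_iff:
  assumes ext: rows_suffice and x: "x \<in> V" "i \<in> slots" "trace x = {i, Suc i}"
    and y: "y \<in> V" "j \<in> slots" "trace y = {j, Suc j}"
  shows "x \<in> N y \<longleftrightarrow> i = j"
proof -
  have "1 * of_bool (x \<in> N y) + sum (tail_wave i) (trace y) = 0"
    by (rule test_function[OF ext x(1) y(1)]) (use diamond_sum[OF x(2)] x(3) in simp)
  then show ?thesis using diamond_sum_slot[OF x(2) y(2)] y(3) by (auto simp: of_bool_def split: if_splits)
qed

text \<open>
  For d at least 2 this says, in terms of G alone, that the canonical graph is a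
  diamond graph over the given path.
\<close>

definition structured :: bool where
  "structured \<longleftrightarrow>
    (\<forall>x\<in>V. (\<exists>k\<le>d. N x = N (v k)) \<or> (\<exists>i\<in>slots. trace x = {i, Suc i})) \<and>
    (\<forall>x\<in>V. \<forall>y\<in>V. \<forall>i\<in>slots. \<forall>j\<in>slots. trace x = {i, Suc i} \<longrightarrow> trace y = {j, Suc j} \<longrightarrow>
      (x \<in> N y \<longleftrightarrow> i = j))"

lemma structured_types:
  assumes structured "x \<in> V"
  shows "(\<exists>k\<le>d. N x = N (v k)) \<or> (\<exists>i\<in>slots. trace x = {i, Suc i})"
  using assms unfolding structured_def by simp

lemma structured_adjacent:
  assumes structured "x \<in> V" "y \<in> V" "i \<in> slots" "j \<in> slots"
    "trace x = {i, Suc i}" "trace y = {j, Suc j}"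
  shows "x \<in> N y \<longleftrightarrow> i = j"
  using assms(1)[unfolded structured_def, THEN conjunct2, rule_format, OF assms(2-)] .

lemma rows_suffice_imp_structured:
  assumes rows_suffice
  shows structured
  unfolding structured_def
proof (intro conjI ballI impI)
  fix x assume "x \<in> V"
  then show "(\<exists>k\<le>d. N x = N (v k)) \<or> (\<exists>i\<in>slots. trace x = {i, Suc i})"
    by (rule trace_cases[OF assms])
next
  fix x y i j
  assume "x \<in> V" "y \<in> V" "i \<in> slots" "j \<in> slots" "trace x = {i, Suc i}" "trace y = {j, Suc j}"
  then show "x \<in> N y \<longleftrightarrow> i = j" by (intro slots_adjacent_iff[OF assms])
qed

lemma trace_twin: "N x = N (v k) \<Longrightarrow> trace x = trace (v k)"
  by (simp add: trace_def)

text \<open>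
  The wave and the functions from \<open>slots_adjacent_iff\<close> are in the kernel of A + I. By symmetry each of
  them is a linear relation between rows: the wave expresses the row at the last path vertex by the other
  path rows, and the switched-on wave expresses the row of a diamond vertex.
\<close>

lemma structured_imp_rows_suffice:
  assumes st: structured
  shows rows_suffice
  unfolding rows_suffice_def
proof (intro allI impI ballI)
  fix g x assume g: "\<forall>i<d. closed_sum G g (v i) = 0" and x: "x \<in> V"
  note types = structured_types[OF st]
  have path_sum: "(\<Sum>j\<le>d. c j * closed_sum G g (v j)) = c d * closed_sum G g (v d)" for c :: "nat \<Rightarrow> real"
  proof -
    have "(\<Sum>j\<le>d. c j * closed_sum G g (v j)) = (\<Sum>j<d. c j * closed_sum G g (v j)) + c d * closed_sum G g (v d)"
      by (simp add: lessThan_Suc_atMost[symmetric])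
    then show ?thesis using g by simp
  qed
  have "sum wave (trace z) = 0" if z: "z \<in> V" for z
    using types[OF z]
  proof (elim disjE exE bexE conjE)
    fix k assume "k \<le> d" "N z = N (v k)"
    then show ?thesis using sum_wave_v[of k] trace_twin[of z k] by simp
  next
    fix i assume "i \<in> slots" "trace z = {i, Suc i}"
    then show ?thesis using wave_slot[of i] by (simp add: diamond_slots_def)
  qed
  then have "wave d * closed_sum G g (v d) = 0"
    using path_sum[of wave] sum_trace_swap[of wave g] by simp
  then have end0: "closed_sum G g (v d) = 0" by (simp add: wave_d)
  have path0: "closed_sum G g (v k) = 0" if "k \<le> d" for k
    using that g end0 by (cases "k = d") auto
  from types[OF x] show "closed_sum G g x = 0"
  proof (elim disjE exE bexE conjE)
    fix k assume "k \<le> d" "N x = N (v k)"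
    then show ?thesis using path0[of k] by (simp add: closed_sum_def)
  next
    fix i assume i: "i \<in> slots" "trace x = {i, Suc i}"
    have tw: "sum (tail_wave i) (trace z) = - of_bool (z \<in> N x)" if z: "z \<in> V" for z
      using types[OF z]
    proof (elim disjE exE bexE conjE)
      fix k assume k: "k \<le> d" "N z = N (v k)"
      have "z \<in> N x \<longleftrightarrow> k \<in> trace x"
        using N_sym[of z x] k(2) trace_iff[OF k(1), of x] by simp
      then show ?thesis using diamond_sum[OF i(1) k(1)] trace_twin[OF k(2)] i(2) by simp
    next
      fix j assume j: "j \<in> slots" "trace z = {j, Suc j}"
      have "z \<in> N x \<longleftrightarrow> j = i" by (rule structured_adjacent[OF st z x j(1) i(1) j(2) i(2)])
      then show ?thesis using diamond_sum_slot[OF i(1) j(1)] j(2) by auto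
    qed
    have "(\<Sum>z\<in>V. g z * sum (tail_wave i) (trace z)) = 0"
      unfolding sum_trace_swap[symmetric] path_sum by (simp add: end0)
    then have "(\<Sum>z\<in>V. - (of_bool (z \<in> N x) * g z)) = 0" using tw by (simp add: mult.commute)
    then have "(\<Sum>z\<in>V. of_bool (z \<in> N x) * g z) = 0" by (simp add: sum_negf)
    moreover have "closed_sum G g x = (\<Sum>z\<in>V. of_bool (z \<in> N x) * g z)"
      unfolding closed_sum_def using closed_neighborhood_subset[OF graph x] finite_V
      by (intro sum.mono_neutral_cong_left) auto
    ultimately show ?thesis by simp
  qed
qed

lemma multiplicity_eq_iff_structured:
  "eigenvalue_multiplicity G (- 1) + d = card V \<longleftrightarrow> structured"
  using multiplicity_eq_iff_rows_suffice[OF d_mod] rows_suffice_imp_structured structured_imp_rows_suffice by blast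

end

section \<open>The diamond graphs\<close>

lemma pverts_path_diamond: "pverts (path_diamond d W) = Inl ` {..d} \<union> Inr ` W"
  by (auto simp: path_diamond_def path_graph_def)

lemma nbhd_path_diamond:
  "i \<le> d \<Longrightarrow> j \<le> d \<Longrightarrow> Inl j \<in> closed_neighborhood (path_diamond d W) (Inl i) \<longleftrightarrow> j \<le> Suc i \<and> i \<le> Suc j"
  "Inr i \<in> closed_neighborhood (path_diamond d W) (Inr j) \<longleftrightarrow> i = j"
  "i \<in> W \<Longrightarrow> Inl k \<in> closed_neighborhood (path_diamond d W) (Inr i) \<longleftrightarrow> k = i \<or> k = Suc i"
  "i \<in> W \<Longrightarrow> Inr i \<in> closed_neighborhood (path_diamond d W) (Inl k) \<longleftrightarrow> k = i \<or> k = Suc i"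
  by (auto simp: closed_neighborhood_def path_diamond_def path_graph_def)

lemma level_path_path_diamond:
  assumes W: "W \<subseteq> {..<d}"
  shows "level_path (path_diamond d W) Inl (case_sum id id) d"
proof (rule level_path.intro)
  show "pair_graph (path_diamond d W)" by (rule pair_graph_path_diamond[OF W])
  fix x y assume "(x, y) \<in> parcs (path_diamond d W)"
  then show "case_sum id id y \<le> Suc (case_sum id id x)"
    by (auto simp: path_diamond_def path_graph_def)
qed (auto simp: pverts_path_diamond path_diamond_def path_graph_def)

context level_path
begin

text \<open>
  The trace of a path vertex consists of its own index and the adjacent ones. For d = 1 both path
  vertices have the trace {0, 1}.
\<close>

lemma trace_v_inj:
  assumes d: "2 \<le> d" and k: "k \<le> d" and l: "l \<le> d" and eq: "trace (v k) = trace (v l)"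
  shows "k = l"
proof -
  have not_less: "\<not> k < l" if k: "k \<le> d" and l: "l \<le> d" and eq: "trace (v k) = trace (v l)" for k l
  proof
    assume kl: "k < l"
    have mem: "m \<in> trace (v k) \<longleftrightarrow> m \<le> Suc k \<and> k \<le> Suc m"
      "m \<in> trace (v l) \<longleftrightarrow> m \<le> Suc l \<and> l \<le> Suc m" if "m \<le> d" for m
      using that by (simp_all add: trace_v[OF k] trace_v[OF l])
    show False
    proof (cases k)
      case 0
      then show False using mem[of 2] mem[of 0] eq kl d by simp
    next
      case (Suc k')
      then show False using mem[of k'] eq kl k by simp
    qed
  qed
  then show ?thesis using not_less[OF k l eq] not_less[OF l k eq[symmetric]] by simp
qed

lemma trace_v_not_slot:
  assumes i: "i \<in> diamond_slots d" and k: "k \<le> d"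
  shows "trace (v k) \<noteq> {i, Suc i}"
proof
  assume eq: "trace (v k) = {i, Suc i}"
  obtain h where h: "i = Suc h" "Suc (Suc i) \<le> d"
    using i by (cases i) (auto simp: diamond_slots_def)
  have mem: "m \<in> {i, Suc i} \<longleftrightarrow> m \<le> Suc k \<and> k \<le> Suc m" if "m \<le> d" for m
    using that unfolding eq[symmetric] by (simp add: trace_v[OF k])
  show False
    using mem[of h] mem[of i] mem[of "Suc i"] mem[of "Suc (Suc i)"] h by auto
qed

end

text \<open>
  The path in the diamond graph is itself a path with a level function, and traces on it already
  separate all vertices.
\<close>

lemma path_diamond_reduced:
  assumes d: "2 \<le> d" and W: "W \<subseteq> diamond_slots d"
    and a: "a \<in> pverts (path_diamond d W)" and b: "b \<in> pverts (path_diamond d W)"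
    and eq: "closed_neighborhood (path_diamond d W) a = closed_neighborhood (path_diamond d W) b"
  shows "a = b"
proof -
  have W': "W \<subseteq> {..<d}" using W by (auto simp: diamond_slots_def)
  interpret P: level_path "path_diamond d W" Inl "case_sum id id" d
    by (rule level_path_path_diamond[OF W'])
  have tr: "P.trace a = P.trace b" unfolding P.trace_def eq ..
  have Inr: "P.trace (Inr i) = {i, Suc i}" if "i \<in> W" for i
    using that W' unfolding P.trace_def nbhd_path_diamond(3)[OF that] by auto
  have slot: "i \<in> diamond_slots d" if "i \<in> W" for i using that W by blast
  from a b consider
      (ll) k l where "a = Inl k" "b = Inl l" "k \<le> d" "l \<le> d"
    | (lr) k i where "a = Inl k" "b = Inr i" "k \<le> d" "i \<in> W"
    | (rl) k i where "a = Inr i" "b = Inl k" "k \<le> d" "i \<in> W"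
    | (rr) i j where "a = Inr i" "b = Inr j" "i \<in> W" "j \<in> W"
    unfolding pverts_path_diamond by auto
  then show ?thesis
  proof cases
    case ll
    then show ?thesis using P.trace_v_inj[OF d] tr by simp
  next
    case lr
    then show ?thesis using P.trace_v_not_slot[OF slot] Inr tr by metis
  next
    case rl
    then show ?thesis using P.trace_v_not_slot[OF slot] Inr tr by metis
  next
    case rr
    then have "{i, Suc i} = {j, Suc j}" using tr Inr by simp
    then have "i = j" by (auto simp: doubleton_eq_iff)
    then show ?thesis using rr by simp
  qed
qed

context wave_path
begin

text \<open>
  Twins of a path vertex are sent to that vertex, and a vertex with trace {i, i + 1} is sent to the
  added vertex over the edge that starts at index i.
\<close>

lemma structured_imp_collapse:
  assumes st: structured and d: "2 \<le> d"
  obtains W t where "W \<subseteq> slots" "collapse G (path_diamond d W) t"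
proof -
  define W where "W = {i \<in> slots. \<exists>x\<in>V. trace x = {i, Suc i}}"
  define t where "t x = (if \<exists>i\<in>slots. trace x = {i, Suc i} then Inr (Min (trace x))
      else Inl (THE k. k \<le> d \<and> trace x = trace (v k)))" for x
  have tr: "t x = Inr i" if "i \<in> slots" "trace x = {i, Suc i}" for x i
  proof -
    have "\<exists>i\<in>slots. trace x = {i, Suc i}" using that by (rule bexI[rotated])
    then show ?thesis using that(2) by (simp add: t_def)
  qed
  have tl: "t x = Inl k" if k: "k \<le> d" "N x = N (v k)" for x k
  proof -
    have tr: "trace x = trace (v k)" by (rule trace_twin[OF k(2)])
    have "\<not> (\<exists>i\<in>slots. trace x = {i, Suc i})"
      unfolding tr using trace_v_not_slot[OF _ k(1)] by blast
    moreover have "(THE l. l \<le> d \<and> trace x = trace (v l)) = k"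
      by (rule the_equality) (use tr k(1) trace_v_inj[OF d] in auto)
    ultimately show ?thesis by (simp add: t_def)
  qed
  have cases: thesis
    if "x \<in> V" "\<And>k. k \<le> d \<Longrightarrow> N x = N (v k) \<Longrightarrow> t x = Inl k \<Longrightarrow> thesis"
      "\<And>i. i \<in> W \<Longrightarrow> i \<in> slots \<Longrightarrow> trace x = {i, Suc i} \<Longrightarrow> t x = Inr i \<Longrightarrow> thesis" for x thesis
    using structured_types[OF st that(1)]
  proof (elim disjE exE bexE conjE)
    fix k assume "k \<le> d" "N x = N (v k)"
    then show thesis using that(2) tl by simp
  next
    fix i assume i: "i \<in> slots" "trace x = {i, Suc i}"
    then have "i \<in> W" using that(1) by (auto simp: W_def)
    then show thesis using i that(3) tr by simp
  qed
  have "t ` V \<subseteq> pverts (path_diamond d W)"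
  proof (rule image_subsetI)
    fix x assume "x \<in> V"
    then show "t x \<in> pverts (path_diamond d W)"
      by (rule cases) (simp_all add: pverts_path_diamond)
  qed
  moreover have "pverts (path_diamond d W) \<subseteq> t ` V"
  proof -
    have "Inl k \<in> t ` V" if "k \<le> d" for k
      using tl[OF that refl] v_in[OF that] by (metis imageI)
    moreover have "Inr i \<in> t ` V" if i: "i \<in> W" for i
    proof -
      obtain x where "x \<in> V" "trace x = {i, Suc i}" "i \<in> slots" using i unfolding W_def by blast
      then show ?thesis using tr[of i x] by (metis imageI)
    qed
    ultimately show ?thesis unfolding pverts_path_diamond by auto
  qed
  moreover have "y \<in> N x \<longleftrightarrow> t y \<in> closed_neighborhood (path_diamond d W) (t x)"
    if x: "x \<in> V" and y: "y \<in> V" for x y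
    using x
  proof (rule cases)
    fix k assume k: "k \<le> d" "N x = N (v k)" "t x = Inl k"
    have yx: "y \<in> N x \<longleftrightarrow> k \<in> trace y" using k(1,2) trace_iff by simp
    show ?thesis
      using y
    proof (rule cases)
      fix l assume l: "l \<le> d" "N y = N (v l)" "t y = Inl l"
      have "trace y = trace (v l)" by (rule trace_twin[OF l(2)])
      then show ?thesis unfolding yx k(3) l(3) using k(1) l(1) by (auto simp: nbhd_path_diamond trace_v)
    next
      fix j assume j: "j \<in> W" "trace y = {j, Suc j}" "t y = Inr j"
      show ?thesis unfolding yx k(3) j(3) using j(1,2) by (simp add: nbhd_path_diamond)
    qed
  next
    fix i assume i: "i \<in> W" "i \<in> slots" "trace x = {i, Suc i}" "t x = Inr i"
    show ?thesis
      using y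
    proof (rule cases)
      fix l assume l: "l \<le> d" "N y = N (v l)" "t y = Inl l"
      have "y \<in> N x \<longleftrightarrow> l \<in> trace x" using l N_sym[of y x] trace_iff by simp
      then show ?thesis unfolding i(4) l(3) using i(1,3) by (simp add: nbhd_path_diamond)
    next
      fix j assume j: "j \<in> W" "j \<in> slots" "trace y = {j, Suc j}" "t y = Inr j"
      have "y \<in> N x \<longleftrightarrow> j = i" by (rule structured_adjacent[OF st y x j(2) i(2) j(3) i(3)])
      then show ?thesis unfolding i(4) j(4) by (simp add: nbhd_path_diamond)
    qed
  qed
  ultimately have "collapse G (path_diamond d W) t" unfolding collapse_def by simp
  moreover have "W \<subseteq> slots" by (auto simp: W_def)
  ultimately show thesis using that by blast
qed

end

text \<open>
  Preimages of the path vertices form a path in G, with the index in the diamond graph as level.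
\<close>

lemma collapse_imp_structured:
  assumes G: "pair_graph G" and t: "collapse G (path_diamond d W) t"
    and W: "W \<subseteq> diamond_slots d" and d: "d mod 3 = 1"
  obtains v level where "wave_path G v level d" "wave_path.structured G v d"
proof -
  let ?H = "path_diamond d W"
  have onto: "t ` pverts G = pverts ?H"
    and nb: "\<And>x y. x \<in> pverts G \<Longrightarrow> y \<in> pverts G \<Longrightarrow>
      y \<in> closed_neighborhood G x \<longleftrightarrow> t y \<in> closed_neighborhood ?H (t x)"
    using t by (auto simp: collapse_def)
  have W': "W \<subseteq> {..<d}" using W by (auto simp: diamond_slots_def)
  (* the path of the diamond graph, whose level function is pulled back along t *)
  interpret H: level_path ?H Inl "case_sum id id" d by (rule level_path_path_diamond[OF W'])
  have "\<exists>x\<in>pverts G. t x = Inl i" if "i \<le> d" for i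
  proof -
    have "Inl i \<in> t ` pverts G" unfolding onto using that by (simp add: pverts_path_diamond)
    then show ?thesis by (rule imageE) (rule bexI, rule sym)
  qed
  then obtain v where v: "\<And>i. i \<le> d \<Longrightarrow> v i \<in> pverts G \<and> t (v i) = Inl i" by metis
  define level where "level x = case_sum id id (t x)" for x
  interpret L: level_path G v level d
  proof (rule level_path.intro)
    show "pair_graph G" by (rule G)
    fix i
    show "i \<le> d \<Longrightarrow> v i \<in> pverts G" using v by simp
    show "i \<le> d \<Longrightarrow> level (v i) = i" using v by (simp add: level_def)
    show "(v i, v (Suc i)) \<in> parcs G" if "i < d"
    proof -
      have "v (Suc i) \<in> closed_neighborhood G (v i)"
        using nb[of "v i" "v (Suc i)"] v[of i] v[of "Suc i"] that by (simp add: nbhd_path_diamond)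
      moreover have "v (Suc i) \<noteq> v i" using v[of i] v[of "Suc i"] that by force
      ultimately show ?thesis by (simp add: closed_neighborhood_def)
    qed
  next
    fix x y assume xy: "(x, y) \<in> parcs G"
    interpret pair_graph G by (rule G)
    have "y \<in> closed_neighborhood G x" using xy by (simp add: closed_neighborhood_def)
    then have "t y \<in> closed_neighborhood ?H (t x)" using nb in_arcsD1[OF xy] in_arcsD2[OF xy] by simp
    then show "level y \<le> Suc (level x)" unfolding level_def by (rule H.level_N)
  qed
  interpret L: wave_path G v level d
    by (rule wave_path.intro[OF L.level_path_axioms wave_path_axioms.intro[OF d]])
  have trace: "L.trace x = {i. i \<le> d \<and> Inl i \<in> closed_neighborhood ?H (t x)}" if "x \<in> pverts G" for x
    using nb[OF that] v by (auto simp: L.trace_def)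
  have types: thesis
    if x: "x \<in> pverts G" and "\<And>k. k \<le> d \<Longrightarrow> t x = Inl k \<Longrightarrow> L.trace x = L.trace (v k) \<Longrightarrow> thesis"
      and "\<And>i. i \<in> W \<Longrightarrow> t x = Inr i \<Longrightarrow> L.trace x = {i, Suc i} \<Longrightarrow> thesis" for x thesis
  proof -
    have "t x \<in> pverts ?H" unfolding onto[symmetric] using x by (rule imageI)
    then consider k where "k \<le> d" "t x = Inl k" | i where "i \<in> W" "t x = Inr i"
      unfolding pverts_path_diamond by auto
    then show thesis
    proof cases
      case 1
      then show thesis using that(2)[of k] trace[OF x] trace[of "v k"] v[of k] by simp
    next
      case (2 i)
      have "i < d" using 2(1) W' by auto
      then have "L.trace x = {i, Suc i}"
        unfolding trace[OF x] 2(2) nbhd_path_diamond(3)[OF 2(1)] by auto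
      then show thesis using that(3) 2 by simp
    qed
  qed
  have "L.structured"
    unfolding L.structured_def
  proof (intro conjI ballI impI)
    fix x assume x: "x \<in> pverts G"
    then show "(\<exists>k\<le>d. closed_neighborhood G x = closed_neighborhood G (v k)) \<or>
        (\<exists>i\<in>diamond_slots d. L.trace x = {i, Suc i})"
    proof (rule types)
      fix k assume k: "k \<le> d" "t x = Inl k"
      have "y \<in> closed_neighborhood G x \<longleftrightarrow> y \<in> closed_neighborhood G (v k)" if "y \<in> pverts G" for y
        using nb[OF x that] nb[of "v k" y] v[OF k(1)] k(2) that by simp
      then have "closed_neighborhood G x = closed_neighborhood G (v k)"
        using closed_neighborhood_subset[OF G x] closed_neighborhood_subset[OF G, of "v k"] v[OF k(1)]
        by auto
      with k(1) show ?thesis by (intro disjI1 exI[of _ k] conjI)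
    next
      fix i assume i: "i \<in> W" and tr: "L.trace x = {i, Suc i}"
      from W i have "i \<in> diamond_slots d" by (rule subsetD)
      with tr show ?thesis by (intro disjI2 bexI[of _ i])
    qed
  next
    have slot: "t x = Inr i" if "x \<in> pverts G" "i \<in> diamond_slots d" "L.trace x = {i, Suc i}" for x i
      using that(1)
    proof (rule types)
      fix k assume "k \<le> d" "L.trace x = L.trace (v k)"
      then show ?thesis using L.trace_v_not_slot[OF that(2), of k] that(3) by simp
    next
      fix j assume j: "t x = Inr j" "L.trace x = {j, Suc j}"
      have "{i, Suc i} = {j, Suc j}" using j(2) that(3) by simp
      then have "i = j" by (auto simp: doubleton_eq_iff)
      then show ?thesis using j(1) by simp
    qed
    fix x y i j
    assume x: "x \<in> pverts G" and y: "y \<in> pverts G" and "i \<in> diamond_slots d" "j \<in> diamond_slots d"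
      "L.trace x = {i, Suc i}" "L.trace y = {j, Suc j}"
    then have "t x = Inr i" "t y = Inr j" using slot by simp_all
    then show "x \<in> closed_neighborhood G y \<longleftrightarrow> i = j"
      using nb[OF y x] by (simp add: nbhd_path_diamond)
  qed
  then show thesis using that L.wave_path_axioms by blast
qed

section \<open>Distances, the diameter and the characterization\<close>

lemma graph_dist_le:
  "pre_digraph.awalk (with_proj G) x p y \<Longrightarrow> graph_dist G x y \<le> length p"
  unfolding graph_dist_def by (rule Least_le) blast

lemma shortest_walk:
  assumes G: "pair_graph G" and conn: "Digraph_Component.connected (with_proj G)"
    and x: "x \<in> pverts G" and y: "y \<in> pverts G"
  obtains p where "pre_digraph.awalk (with_proj G) x p y" "length p = graph_dist G x y"
proof -
  interpret pair_graph G by (rule G)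
  have "x \<rightarrow>\<^sup>*\<^bsub>mk_symmetric (with_proj G)\<^esub> y"
    using conn x y by (simp add: Digraph_Component.connected_def strongly_connected_def)
  then have "x \<rightarrow>\<^sup>*\<^bsub>with_proj G\<^esub> y" using reachable_mk_symmetric_eq[OF pair_sym_arcs] by simp
  then obtain q where "awalk x q y" using reachable_awalk by auto
  then have "\<exists>k p. awalk x p y \<and> length p = k" by blast
  then have "\<exists>p. awalk x p y \<and> length p = graph_dist G x y"
    unfolding graph_dist_def by (rule LeastI_ex)
  then show thesis using that by blast
qed

lemma distance_level_arc:
  assumes G: "pair_graph G" and conn: "Digraph_Component.connected (with_proj G)"
    and u: "u \<in> pverts G" and xy: "(x, y) \<in> parcs G"
  shows "graph_dist G u y \<le> Suc (graph_dist G u x)"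
proof -
  interpret pair_graph G by (rule G)
  obtain p where p: "awalk u p x" "length p = graph_dist G u x"
    using shortest_walk[OF G conn u in_arcsD1[OF xy]] .
  have "awalk x [(x, y)] y" using xy in_arcsD1[OF xy] in_arcsD2[OF xy] by (simp add: awalk_simps)
  then have "awalk u (p @ [(x, y)]) y" by (rule awalk_appendI[OF p(1)])
  then have "graph_dist G u y \<le> length (p @ [(x, y)])" by (rule graph_dist_le)
  then show ?thesis using p(2) by simp
qed

text \<open>
  A shortest walk to x is obtained by stepping back to a vertex that is one closer to u.
\<close>

lemma distance_level_path:
  assumes G: "pair_graph G" and conn: "Digraph_Component.connected (with_proj G)"
    and u: "u \<in> pverts G"
  shows "x \<in> pverts G \<Longrightarrow> graph_dist G u x = k \<Longrightarrow>
    \<exists>v. level_path G v (graph_dist G u) k \<and> v k = x"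
proof (induction k arbitrary: x)
  case 0
  then have "level_path G (\<lambda>_. x) (graph_dist G u) 0"
    using G distance_level_arc[OF G conn u] by (intro level_path.intro) simp_all
  then show ?case by blast
next
  case (Suc k)
  interpret pair_graph G by (rule G)
  obtain p where p: "awalk u p x" "length p = Suc k"
    using shortest_walk[OF G conn u Suc.prems(1)] Suc.prems(2) by metis
  then obtain q e where qe: "p = q @ [e]" "length q = k" by (metis length_Suc_conv_rev)
  define y where "y = fst e"
  have q: "awalk u q y" and e: "(y, x) \<in> parcs G"
    using p(1) unfolding qe(1) y_def by (auto simp: awalk_simps)
  have y: "y \<in> pverts G" by (rule in_arcsD1[OF e])
  have "graph_dist G u y \<le> k" using graph_dist_le[OF q] qe(2) by simp
  moreover have "Suc k \<le> Suc (graph_dist G u y)"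
    using distance_level_arc[OF G conn u e] Suc.prems(2) by simp
  ultimately have "graph_dist G u y = k" by simp
  then obtain v where v: "level_path G v (graph_dist G u) k" "v k = y" using Suc.IH[OF y] by blast
  interpret v: level_path G v "graph_dist G u" k by (rule v(1))
  have "level_path G (v(Suc k := x)) (graph_dist G u) (Suc k)"
  proof (rule level_path.intro)
    show "pair_graph G" by (rule G)
    fix i
    show "i \<le> Suc k \<Longrightarrow> (v(Suc k := x)) i \<in> pverts G" using v.v_in Suc.prems(1) by simp
    show "i \<le> Suc k \<Longrightarrow> graph_dist G u ((v(Suc k := x)) i) = i" using v.level_v Suc.prems(2) by simp
    show "i < Suc k \<Longrightarrow> ((v(Suc k := x)) i, (v(Suc k := x)) (Suc i)) \<in> parcs G"
      using v.v_step v(2) e by (cases "i = k") simp_all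
  next
    fix a b assume "(a, b) \<in> parcs G"
    then show "graph_dist G u b \<le> Suc (graph_dist G u a)" by (rule distance_level_arc[OF G conn u])
  qed
  then show ?case by (intro exI[of _ "v(Suc k := x)"] conjI fun_upd_same)
qed

lemma finite_distances:
  assumes "pair_graph G"
  shows "finite {graph_dist G u v |u v. u \<in> pverts G \<and> v \<in> pverts G}"
proof -
  interpret pair_graph G by fact
  have "{graph_dist G u v |u v. u \<in> pverts G \<and> v \<in> pverts G}
      = case_prod (graph_dist G) ` (pverts G \<times> pverts G)" by auto
  then show ?thesis using pair_finite_verts by simp
qed

lemma diametral_level_path:
  assumes G: "pair_graph G" and conn: "Digraph_Component.connected (with_proj G)"
  obtains v level where "level_path G v level (graph_diameter G)"
proof -
  let ?D = "{graph_dist G u v |u v. u \<in> pverts G \<and> v \<in> pverts G}"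
  have "pverts G \<noteq> {}"
    using conn by (simp add: Digraph_Component.connected_def strongly_connected_def)
  then have "?D \<noteq> {}" by auto
  then have "graph_diameter G \<in> ?D"
    unfolding graph_diameter_def by (rule Max_in[OF finite_distances[OF G]])
  then obtain u x where u: "u \<in> pverts G" and x: "x \<in> pverts G" "graph_dist G u x = graph_diameter G"
    by auto
  show thesis using distance_level_path[OF G conn u x] that by blast
qed

lemma (in level_path) level_awalk:
  assumes "pre_digraph.awalk (with_proj G) x p y"
  shows "level y \<le> level x + length p"
proof -
  interpret pair_graph G by (rule graph)
  show ?thesis using assms
  proof (induction p arbitrary: x)
    case Nil
    then show ?case by (simp add: awalk_simps)
  next
    case (Cons e p)
    then have "e \<in> parcs G" "fst e = x" "awalk (snd e) p y" by (simp_all add: awalk_simps)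
    then show ?case using Cons.IH[of "snd e"] level_arc[of x "snd e"] by (cases e) simp
  qed
qed

text \<open>
  Along a walk the level grows by at most 1 per arc.
\<close>

lemma (in level_path) diameter_ge:
  assumes conn: "Digraph_Component.connected (with_proj G)"
  shows "d \<le> graph_diameter G"
proof -
  obtain p where "pre_digraph.awalk (with_proj G) (v 0) p (v d)" "length p = graph_dist G (v 0) (v d)"
    using shortest_walk[OF graph conn v_in v_in, of 0 d] by auto
  then have "d \<le> graph_dist G (v 0) (v d)" using level_awalk level_v[of 0] level_v[of d] by fastforce
  also have "\<dots> \<le> graph_diameter G"
    unfolding graph_diameter_def by (rule Max_ge[OF finite_distances[OF graph]]) (use v_in in blast)
  finally show ?thesis .
qed

text \<open>
  A path of length d of this kind bounds the diameter from below. The multiplicity bound for a diametral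
  path bounds it from above, so no walks of length d have to be constructed.
\<close>

lemma (in level_path) diameter_eq:
  assumes conn: "Digraph_Component.connected (with_proj G)"
    and mult: "eigenvalue_multiplicity G (- 1) + d = card V"
  shows "graph_diameter G = d"
proof -
  obtain w l where "level_path G w l (graph_diameter G)" using diametral_level_path[OF graph conn] .
  then have "eigenvalue_multiplicity G (- 1) + graph_diameter G \<le> card V"
    by (rule level_path.multiplicity_bound)
  then show ?thesis using diameter_ge[OF conn] mult by simp
qed

text \<open>
  All closed neighborhoods are equal, so any two distinct vertices serve as the path.
\<close>

lemma complete_imp_structured:
  assumes complete: "complete_digraph n (with_proj G)" and n: "2 \<le> n"
  obtains v level where "wave_path G v level 1" "wave_path.structured G v 1"
proof -
  have fin: "finite (pverts G)" and card: "card (pverts G) = n"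
    and arcs: "parcs G = {(u, v). (u, v) \<in> pverts G \<times> pverts G \<and> u \<noteq> v}"
    using complete unfolding complete_digraph_pair_def by simp_all
  have G: "pair_graph G" by (rule pair_graphI_complete[OF complete])
  obtain a where a: "a \<in> pverts G" using card n by fastforce
  have "card (pverts G - {a}) \<noteq> 0" using card n a fin by simp
  then have "pverts G - {a} \<noteq> {}" by force
  then obtain b where b: "b \<in> pverts G" "b \<noteq> a" by blast
  define v where "v i = (if i = 0 then a else b)" for i :: nat
  define level where "level x = (if x = a then 0 else 1::nat)" for x
  interpret L: level_path G v level 1
    using G a b by (intro level_path.intro) (auto simp: v_def level_def arcs le_Suc_eq)
  interpret L: wave_path G v level 1
    by (intro wave_path.intro L.level_path_axioms wave_path_axioms.intro) simp
  have N: "closed_neighborhood G x = pverts G" if "x \<in> pverts G" for x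
    using that by (auto simp: closed_neighborhood_def arcs)
  have no_slots: "diamond_slots 1 = {}" by (auto simp: diamond_slots_def)
  have "L.structured"
    unfolding L.structured_def no_slots
  proof (intro conjI ballI impI)
    fix x assume x: "x \<in> pverts G"
    have "closed_neighborhood G x = closed_neighborhood G (v 0)"
      unfolding N[OF x] using N[OF L.v_in[of 0]] by simp
    then show "(\<exists>k\<le>1. closed_neighborhood G x = closed_neighborhood G (v k)) \<or>
        (\<exists>i\<in>{}. L.trace x = {i, Suc i})"
      by (intro disjI1 exI[of _ 0] conjI le0)
  qed simp_all
  then show thesis using that L.wave_path_axioms by blast
qed

text \<open>
  There are no diamond vertices for d = 1, and both path vertices have the trace {0, 1}. So all
  vertices are twins of each other.
\<close>

lemma (in wave_path) structured_imp_complete: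
  assumes st: structured and d: "d = 1"
  shows "complete_digraph (card V) (with_proj G)" "2 \<le> card V"
proof -
  interpret pair_graph G by (rule graph)
  have ext: rows_suffice by (rule structured_imp_rows_suffice[OF st])
  have no_slots: "slots = {}" using d by (auto simp: diamond_slots_def)
  have trace: "trace x = {0, 1}" if "x \<in> V" for x
    using structured_types[OF st that] unfolding no_slots
  proof (elim disjE exE bexE conjE)
    fix k assume k: "k \<le> d" "N x = N (v k)"
    have "trace (v k) = {0, 1}" unfolding trace_v[OF k(1)] using k(1) d by auto
    then show ?thesis using trace_twin[OF k(2)] by simp
  qed simp
  have adjacent: "(x, y) \<in> parcs G" if x: "x \<in> V" and y: "y \<in> V" and "x \<noteq> y" for x y
  proof -
    have "N x = N y" using same_trace_twins[OF ext x y] trace[OF x] trace[OF y] by simp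
    then have "y \<in> N x" using self_N by simp
    then show ?thesis using \<open>x \<noteq> y\<close> by (simp add: closed_neighborhood_def)
  qed
  have "parcs G = {(u, v). (u, v) \<in> V \<times> V \<and> u \<noteq> v}"
  proof (intro equalityI subrelI)
    fix x y assume "(x, y) \<in> parcs G"
    then show "(x, y) \<in> {(u, v). (u, v) \<in> V \<times> V \<and> u \<noteq> v}"
      using in_arcsD1[of x y] in_arcsD2[of x y] no_loops'[of x y] by simp
  qed (use adjacent in simp)
  then show "complete_digraph (card V) (with_proj G)"
    unfolding complete_digraph_pair_def using finite_V by simp
  have "card (v ` {..<2}) \<le> card V" by (rule card_mono[OF finite_V v_subset]) (simp add: d)
  then show "2 \<le> card V" using card_v[of 2] d by simp
qed

text \<open>
  Without added vertices the diamond graph is the path, apart from the tag on its vertices.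
\<close>

lemma digraph_iso_path_graph_iff:
  assumes G: "pair_graph G"
  shows "digraph_iso (with_proj G) (with_proj (path_graph (Suc d))) \<longleftrightarrow>
    digraph_iso (with_proj G) (with_proj (path_diamond d {}))" (is "?P \<longleftrightarrow> ?D")
proof
  have P: "pair_graph (path_graph (Suc d))" by (rule pair_graph_path_graph)
  have D: "pair_graph (path_diamond d {})" by (rule pair_graph_path_diamond) simp
  have verts: "pverts (path_diamond d {}) = Inl ` pverts (path_graph (Suc d))"
    and arcs: "\<And>i j. (Inl i, Inl j) \<in> parcs (path_diamond d {}) \<longleftrightarrow> (i, j) \<in> parcs (path_graph (Suc d))"
    by (auto simp: path_diamond_def)
  have inl: "bij_betw Inl (pverts (path_graph (Suc d))) (pverts (path_diamond d {}))"
    unfolding verts by (simp add: bij_betw_def)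
  have projl: "bij_betw projl (pverts (path_diamond d {})) (pverts (path_graph (Suc d)))"
    unfolding verts by (auto simp: bij_betw_def inj_on_def image_image)
  {
    assume ?P
    then obtain f where f: "bij_betw f (pverts G) (pverts (path_graph (Suc d)))"
      "\<forall>u\<in>pverts G. \<forall>v\<in>pverts G. (u, v) \<in> parcs G \<longleftrightarrow> (f u, f v) \<in> parcs (path_graph (Suc d))"
      unfolding digraph_iso_pair_graph_iff[OF G P] by blast
    show ?D
      unfolding digraph_iso_pair_graph_iff[OF G D]
      by (intro exI[of _ "Inl \<circ> f"] conjI bij_betw_trans[OF f(1) inl]) (use f(2) in \<open>simp add: arcs\<close>)
  next
    assume ?D
    then obtain f where f: "bij_betw f (pverts G) (pverts (path_diamond d {}))"
      "\<forall>u\<in>pverts G. \<forall>v\<in>pverts G. (u, v) \<in> parcs G \<longleftrightarrow> (f u, f v) \<in> parcs (path_diamond d {})"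
      unfolding digraph_iso_pair_graph_iff[OF G D] by blast
    have "f u = Inl (projl (f u))" if "u \<in> pverts G" for u
    proof -
      have "f u \<in> Inl ` pverts (path_graph (Suc d))"
        using bij_betwE[OF f(1)] that unfolding verts by blast
      then show ?thesis by auto
    qed
    then have "(f u, f v) \<in> parcs (path_diamond d {}) \<longleftrightarrow>
        (projl (f u), projl (f v)) \<in> parcs (path_graph (Suc d))" if "u \<in> pverts G" "v \<in> pverts G" for u v
      using arcs[of "projl (f u)" "projl (f v)"] that by simp
    then show ?P
      unfolding digraph_iso_pair_graph_iff[OF G P]
      by (intro exI[of _ "projl \<circ> f"] conjI bij_betw_trans[OF f(1) projl]) (use f(2) in simp)
  }
qed

lemma diamond_iso_imp_multiplicity:
  assumes G: "pair_graph G" and conn: "Digraph_Component.connected (with_proj G)"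
    and d: "d mod 3 = 1" and W: "W \<subseteq> diamond_slots d"
    and iso: "digraph_iso (with_proj (canonical_graph G)) (with_proj (path_diamond d W))"
  shows "eigenvalue_multiplicity G (- 1) + d = card (pverts G)" "graph_diameter G = d"
proof -
  have "W \<subseteq> {..<d}" using W by (auto simp: diamond_slots_def)
  from canonical_iso_imp_collapse[OF G pair_graph_path_diamond[OF this] iso]
  obtain t where "collapse G (path_diamond d W) t" .
  from collapse_imp_structured[OF G this W d]
  obtain v level where v: "wave_path G v level d" "wave_path.structured G v d" .
  interpret wave_path G v level d by (rule v(1))
  show mult: "eigenvalue_multiplicity G (- 1) + d = card (pverts G)"
    using multiplicity_eq_iff_structured v(2) by blast
  show "graph_diameter G = d" by (rule diameter_eq[OF conn mult])
qed

theorem theorem1p3: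
  fixes G :: "'a pair_pre_digraph" and n d :: nat
  assumes "pair_graph G"
    and "Digraph_Component.connected (with_proj G)"
    and "n = card (pverts G)"
    and "d = graph_diameter G"
  shows "int (eigenvalue_multiplicity G (- 1)) = int n - int d \<longleftrightarrow>
      (complete_digraph n (with_proj G) \<and> n \<ge> 2)
    \<or> digraph_iso (with_proj (canonical_graph G)) (with_proj (path_graph 5))
    \<or> (d \<ge> 7 \<and> d mod 3 = 1 \<and>
        (\<exists>W. W \<subseteq> {j. 3 dvd j \<and> 3 \<le> j \<and> j \<le> d - 4} \<and>
          digraph_iso (with_proj (canonical_graph G)) (with_proj (path_diamond d W))))"
    (is "?M \<longleftrightarrow> ?complete \<or> ?path \<or> ?diamond")
proof -
  note G = assms(1) and conn = assms(2)
  have M: "?M \<longleftrightarrow> eigenvalue_multiplicity G (- 1) + d = card (pverts G)"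
    unfolding assms(3) by linarith
  have path: "?path \<longleftrightarrow> digraph_iso (with_proj (canonical_graph G)) (with_proj (path_diamond 4 {}))"
    using digraph_iso_path_graph_iff[OF pair_graph_canonical_graph[OF G], of 4] by simp
  have slots: "{j. 3 dvd j \<and> 3 \<le> j \<and> j \<le> d - 4} = diamond_slots d"
    by (simp add: diamond_slots_def)
  show ?thesis
  proof
    assume ?M
    then have mult: "eigenvalue_multiplicity G (- 1) + d = card (pverts G)" using M by simp
    obtain v level where "level_path G v level d"
      using diametral_level_path[OF G conn] assms(4) by blast
    then interpret level_path G v level d .
    have d: "d mod 3 = 1" by (rule multiplicity_eq_imp_mod[OF mult])
    interpret wave_path G v level d
      by (rule wave_path.intro[OF level_path_axioms wave_path_axioms.intro[OF d]])
    have st: structured using multiplicity_eq_iff_structured mult by simp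
    have iso: "\<exists>W\<subseteq>diamond_slots d. digraph_iso (with_proj (canonical_graph G)) (with_proj (path_diamond d W))"
      if d2: "2 \<le> d"
    proof -
      obtain W t where W: "W \<subseteq> diamond_slots d" "collapse G (path_diamond d W) t"
        using structured_imp_collapse[OF st d2] .
      have "W \<subseteq> {..<d}" using W(1) by (auto simp: diamond_slots_def)
      then have "digraph_iso (with_proj (canonical_graph G)) (with_proj (path_diamond d W))"
        by (intro collapse_imp_canonical_iso[OF G pair_graph_path_diamond W(2)]
            path_diamond_reduced[OF d2 W(1)])
      then show ?thesis using W(1) by blast
    qed
    have "d = 1 \<or> d = 4 \<or> 7 \<le> d" using d by presburger
    then consider "d = 1" | "d = 4" | "7 \<le> d" by blast
    then show "?complete \<or> ?path \<or> ?diamond"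
    proof cases
      case 1
      then show ?thesis using structured_imp_complete[OF st] assms(3) by simp
    next
      case 2
      have "diamond_slots 4 = {}" by (auto simp: diamond_slots_def)
      then show ?thesis using iso 2 path by auto
    next
      case 3
      then show ?thesis unfolding slots using iso d by auto
    qed
  next
    assume "?complete \<or> ?path \<or> ?diamond"
    then show ?M
    proof (elim disjE)
      assume c: ?complete
      then obtain v level where v: "wave_path G v level 1" "wave_path.structured G v 1"
        using complete_imp_structured by blast
      interpret wave_path G v level 1 by (rule v(1))
      have "eigenvalue_multiplicity G (- 1) + 1 = card (pverts G)"
        using multiplicity_eq_iff_structured v(2) by blast
      then show ?M using diameter_eq[OF conn] M assms(4) by simp
    next
      assume ?path
      then show ?M using diamond_iso_imp_multiplicity[OF G conn, of 4 "{}"] path M assms(4) by simp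
    next
      assume ?diamond
      then show ?M unfolding slots using diamond_iso_imp_multiplicity(1)[OF G conn] M by blast
    qed
  qed
qed

end
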